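(* Let $m\ge0$, $\boldsymbol r=(r_0,\dots,r_d)$ with $r_d=0$, $r_{d-1}=m$, $r_\ell\ge2r_{\ell+1}$ for $\ell=d-2,\dots,0$, and $k\ge2r_0+1$. Let $T\subset\mathbb R^d$ be a $d$-simplex of a conforming triangulation $\mathcal T_h$, and for each sub-simplex $f$ of $T$ of dimension $\ell\le d-1$ let $n_f$ be the local (rescaled tangential-normal) basis and $N_f=\{\boldsymbol N_f^1,\dots,\boldsymbol N_f^{d-\ell}\}$ a global basis (depending only on $f$) of the normal plane of $f$, with $\hat N_f=\{\hat{\boldsymbol N}_f^1,\dots,\hat{\boldsymbol N}_f^{d-\ell}\}$ the basis of the normal plane dual to $N_f$. For $\alpha\in\mathbb T_k^d$, with $f$ the unique sub-simplex such that $\alpha\in S_\ell(f)$, set $$\mathtt L^\alpha(u)=\Big\langle\mathtt b^{\alpha_f},\frac{\partial^{|\alpha_{f^*}|}u}{\partial n_f^{\alpha_{f^*}}}\Big|_f\Big\rangle,\qquad \mathtt G^\alpha(u)=\Big\langle\mathtt b^{\alpha_f},\frac{\partial^{|\alpha_{f^*}|}u}{\partial N_f^{\alpha_{f^*}}}\Big|_f\Big\rangle,\qquad u\in\mathbb P_k(T).$$ Let $\{\psi_\alpha\}_{\alpha\in\mathbb T_k^d}\subset\mathbb P_k(T)$ be the basis dual to $\{\mathtt L^\alpha\}_{\alpha\in\mathbb T_k^d}$. Define the matrix $(T_{\alpha,\beta})_{\alpha,\beta\in\mathbb T_k^d}$ by $$T_{\alpha,\beta}=\begin{cases}\dfrac{s!}{\beta_{f^*}!}\,\operatorname{sym}(n_f^{\otimes\alpha_{f^*}}):\operatorname{sym}(\hat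 N_f^{\otimes\beta_{f^*}}), & \text{if }\alpha,\beta\in S_\ell(f)\cap L(f,s)\text{ for some } f,\ell,s,\text{ and }\alpha_f=\beta_f,\\[1ex] 0,&\text{otherwise.}\end{cases}$$ Then the basis of $\mathbb P_k(T)$ dual to $\{\mathtt G^\beta\}_{\beta\in\mathbb T_k^d}$ is obtained by applying the transpose of $(T_{\alpha,\beta})$ to $(\psi_\alpha)$, i.e. it is $\{\phi_\beta\}_{\beta\in\mathbb T_k^d}$ with $$\phi_\beta=\sum_{\alpha\in\mathbb T_k^d}T_{\alpha,\beta}\,\psi_\alpha .$$
   Context: Notation. $T$ has vertices indexed $0,\dots,d$ and barycentric coordinates $\lambda_0,\dots,\lambda_d$; $\mathbb P_k(T)$ is the space of polynomials of degree $\le k$. $\mathbb T_k^d=\{\alpha\in\mathbb N^{d+1}:|\alpha|=k\}$ (with $0\in\mathbb N$). An $\ell$-dimensional sub-simplex $f\in\Delta_\ell(T)$ is a set of $\ell+1$ vertices with a fixed ordering (ascending in the global vertex index of $\mathcal T_h$), identified with its convex hull; $f^*$ is the complementary set of vertices; $\alpha_f$, $\alpha_{f^*}$ are the tuples of components of $\alpha$ at the vertices of $f$, $f^*$. $\operatorname{dist}(\alpha,f)=|\alpha_{f^*}|$ ($0$ for $f=T$), $L(f,s)=\{\alpha\in\mathbb T_k^d:\operatorname{dist}(\alpha,f)=s\}$, $D(f,r)=\{\alpha\in\mathbb T_k^d:\operatorname{dist}(\alpha,f)\le r\}$, $$S_\ell(f)=D(f,r_\ell)\setminus\bigcup_{i=0}^{\ell-1}\bigcup_{e\in\Delta_i(f)}D(e,r_i).$$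 Under the stated hypotheses $\mathbb T_k^d$ is known to be the disjoint union of the sets $S_\ell(f)$, $f\in\Delta_\ell(T)$, $0\le\ell\le d$. Dual functionals. For a degree $j$, $B_f^\mu=\frac{j!}{\mu!}\prod_{i=0}^\ell\lambda_{f(i)}^{\mu_i}$, $\mu\in\mathbb T_j^\ell$, is the Bernstein basis of $\mathbb P_j(f)$ and $\{\mathtt b^\mu\}\subset\mathbb P_j(f)'$ its dual basis; $\mathtt b^{\alpha_f}$ acts on $\mathbb P_{|\alpha_f|}(f)$. Normal bases. $\nabla_{f\cup\{i\}}\lambda_i$ is the orthogonal projection of $\nabla\lambda_i$ onto the tangent space of the sub-simplex $f\cup\{i\}$, and $n_f=\{\nabla_{f\cup\{i\}}\lambda_i/|\nabla_{f\cup\{i\}}\lambda_i|^2:i\in f^*\}$, ordered as $f^*$. The normal plane of $f$ is the orthogonal complement of its tangent space; $\hat N_f$ lies in the normal plane and satisfies $\hat{\boldsymbol N}_f^i\cdot\boldsymbol N_f^j=\delta_{ij}$. Tensors. For vectors $n=(\boldsymbol n_1,\dots,\boldsymbol n_p)$ in $\mathbb R^d$ and $\gamma\in\mathbb N^p$ with $|\gamma|=s$, $n^{\otimes\gamma}=\boldsymbol n_1^{\otimes\gamma_1}\otimes\cdots\otimes\boldsymbol n_p^{\otimes\gamma_p}$, $\operatorname{sym}$ is the average over all permutations of the $s$ tensor slots, $:$ is the Euclidean inner product on $(\mathbb R^d)^{\otimes s}$, and $\frac{\partial^s u}{\partial n^\gamma}=\nabla^su:n^{\otimes\gamma}$. For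 $f=T$ the multi-index $\alpha_{f^*}$ is empty, no derivative is taken, and the tensor factor in $T_{\alpha,\beta}$ equals $1$. "$\{\phi_\beta\}$ dual to $\{\mathtt G^\beta\}$" means $\mathtt G^\alpha(\phi_\beta)=\delta_{\alpha,\beta}$. *)

theory Defs
  imports "HOL-Analysis.Analysis" "HOL-Combinatorics.Permutations"
begin

text \<open>
  The space dimension \<open>d\<close> is \<open>CARD('n)\<close>.  A simplex \<open>T\<close> is given by the enumeration
  \<open>v 0, \<dots>, v d\<close> of its vertices; \<open>gix\<close> is the global index of the vertices of the triangulation.
  A sub-simplex is the nonempty set \<open>f \<subseteq> {..d}\<close> of the local indices of its vertices.
\<close>

text \<open>Tuples of \<open>l + 1\<close> natural numbers of sum \<open>j\<close>, as lists.\<close>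

definition lattice :: "nat \<Rightarrow> nat \<Rightarrow> nat list set" where
  "lattice l j = {\<mu>. length \<mu> = l + 1 \<and> sum_list \<mu> = j}"

definition mfact :: "nat list \<Rightarrow> real" where
  "mfact \<mu> = prod_list (map fact \<mu>)"

definition subsimplices :: "nat \<Rightarrow> nat set \<Rightarrow> nat set set" where
  "subsimplices l f = {e. e \<subseteq> f \<and> card e = l + 1}"

definition ldist :: "nat list \<Rightarrow> nat set \<Rightarrow> nat" where
  "ldist \<alpha> f = (\<Sum>i\<in>{..<length \<alpha>} - f. \<alpha> ! i)"

definition latticeL :: "nat \<Rightarrow> nat \<Rightarrow> nat set \<Rightarrow> nat \<Rightarrow> nat list set" where
  "latticeL d k f s = {\<alpha> \<in> lattice d k. ldist \<alpha> f = s}"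

definition latticeD :: "nat \<Rightarrow> nat \<Rightarrow> nat set \<Rightarrow> nat \<Rightarrow> nat list set" where
  "latticeD d k f s = {\<alpha> \<in> lattice d k. ldist \<alpha> f \<le> s}"

definition latticeS :: "nat \<Rightarrow> nat \<Rightarrow> (nat \<Rightarrow> nat) \<Rightarrow> nat \<Rightarrow> nat set \<Rightarrow> nat list set" where
  "latticeS d k r l f =
     latticeD d k f (r l) - (\<Union>i<l. \<Union>e\<in>subsimplices i f. latticeD d k e (r i))"

definition owner :: "nat \<Rightarrow> nat \<Rightarrow> (nat \<Rightarrow> nat) \<Rightarrow> nat list \<Rightarrow> nat set" where
  "owner d k r \<alpha> = (THE f. \<exists>l\<le>d. f \<in> subsimplices l {..d} \<and> \<alpha> \<in> latticeS d k r l f)"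

definition vlist :: "(real^'n \<Rightarrow> nat) \<Rightarrow> (nat \<Rightarrow> real^'n) \<Rightarrow> nat set \<Rightarrow> nat list" where
  "vlist gix v f = sorted_key_list_of_set (\<lambda>i. gix (v i)) f"

definition opp :: "(nat \<Rightarrow> real^'n) \<Rightarrow> nat set \<Rightarrow> nat set" where
  "opp v f = {..CARD('n)} - f"

text \<open>The tuple \<open>\<alpha>\<^sub>f\<close>, in the order of \<open>vlist\<close>.\<close>

definition comps :: "(real^'n \<Rightarrow> nat) \<Rightarrow> (nat \<Rightarrow> real^'n) \<Rightarrow> nat list \<Rightarrow> nat set \<Rightarrow> nat list" where
  "comps gix v \<alpha> f = map ((!) \<alpha>) (vlist gix v f)"

definition bary :: "(nat \<Rightarrow> real^'n) \<Rightarrow> nat \<Rightarrow> real^'n \<Rightarrow> real" where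
  "bary v i x =
     (THE c. (\<forall>j. j \<notin> {..CARD('n)} \<longrightarrow> c j = 0) \<and>
             (\<Sum>j\<le>CARD('n). c j) = 1 \<and> (\<Sum>j\<le>CARD('n). c j *\<^sub>R v j) = x) i"

text \<open>The barycentric coordinates are affine, so their gradients are constant vectors.\<close>

definition grad_bary :: "(nat \<Rightarrow> real^'n) \<Rightarrow> nat \<Rightarrow> real^'n" where
  "grad_bary v i = (THE g. \<forall>x. GDERIV (bary v i) x :> g)"

definition tangent_space :: "(nat \<Rightarrow> real^'n) \<Rightarrow> nat set \<Rightarrow> (real^'n) set" where
  "tangent_space v f = span {v i - v j | i j. i \<in> f \<and> j \<in> f}"

definition normal_plane :: "(nat \<Rightarrow> real^'n) \<Rightarrow> nat set \<Rightarrow> (real^'n) set" where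
  "normal_plane v f = (tangent_space v f)\<^sup>\<bottom>"

definition orth_proj :: "(real^'n) set \<Rightarrow> real^'n \<Rightarrow> real^'n" where
  "orth_proj S x = (THE p. p \<in> S \<and> x - p \<in> S\<^sup>\<bottom>)"

definition tn_vector :: "(nat \<Rightarrow> real^'n) \<Rightarrow> nat set \<Rightarrow> nat \<Rightarrow> real^'n" where
  "tn_vector v f i =
     (let w = orth_proj (tangent_space v (insert i f)) (grad_bary v i) in w /\<^sub>R (norm w)\<^sup>2)"

definition tn_frame :: "(real^'n \<Rightarrow> nat) \<Rightarrow> (nat \<Rightarrow> real^'n) \<Rightarrow> nat set \<Rightarrow> (real^'n) list" where
  "tn_frame gix v f = map (tn_vector v f) (vlist gix v (opp v f))"

text \<open>
  A global family \<open>N\<close> of frames is indexed by the set of the vertices (as points) of the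
  sub-simplex, so that it does not depend on the simplex \<open>T\<close> containing it.
  The vectors are \<open>N F 0, \<dots>, N F (d - l - 1)\<close>; for \<open>f = T\<close> the frame is empty.
\<close>

definition frame ::
  "((real^'n) set \<Rightarrow> nat \<Rightarrow> real^'n) \<Rightarrow> (nat \<Rightarrow> real^'n) \<Rightarrow> nat set \<Rightarrow> (real^'n) list" where
  "frame N v f = map (N (v ` f)) [0..<card (opp v f)]"

definition normal_basis :: "(nat \<Rightarrow> real^'n) \<Rightarrow> nat set \<Rightarrow> (nat \<Rightarrow> real^'n) \<Rightarrow> bool" where
  "normal_basis v f B \<longleftrightarrow>
     inj_on B {..<card (opp v f)} \<and> independent (B ` {..<card (opp v f)}) \<and>
     span (B ` {..<card (opp v f)}) = normal_plane v f"

text \<open>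
  A tensor of order \<open>s\<close> over \<open>\<real>\<^sup>d\<close> is given by its entries, indexed by the lists of length \<open>s\<close>
  over \<open>'n\<close>.
\<close>

definition tprod :: "(real^'n) list \<Rightarrow> 'n list \<Rightarrow> real" where
  "tprod ws I = (\<Prod>j<length ws. (ws ! j) $ (I ! j))"

definition tpow :: "(real^'n) list \<Rightarrow> nat list \<Rightarrow> 'n list \<Rightarrow> real" where
  "tpow ns \<gamma> = tprod (concat (map2 replicate \<gamma> ns))"

definition tsym :: "nat \<Rightarrow> ('n list \<Rightarrow> real) \<Rightarrow> 'n list \<Rightarrow> real" where
  "tsym s A I = (\<Sum>p | p permutes {..<s}. A (permute_list p I)) / fact s"

definition tinner :: "nat \<Rightarrow> ('n::finite list \<Rightarrow> real) \<Rightarrow> ('n list \<Rightarrow> real) \<Rightarrow> real" where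
  "tinner s A B = (\<Sum>I | length I = s. A I * B I)"

text \<open>The entries of \<open>\<nabla>\<^sup>s u (x)\<close>, \<open>s\<close> being the length of the index list.\<close>

fun nabla :: "(real^'n \<Rightarrow> real) \<Rightarrow> 'n list \<Rightarrow> real^'n \<Rightarrow> real" where
  "nabla u [] = u"
| "nabla u (i # I) = (\<lambda>x. frechet_derivative (nabla u I) (at x) (axis i 1))"

definition frame_deriv :: "(real^'n) list \<Rightarrow> nat list \<Rightarrow> (real^'n \<Rightarrow> real) \<Rightarrow> real^'n \<Rightarrow> real" where
  "frame_deriv ns \<gamma> u x = tinner (sum_list \<gamma>) (\<lambda>I. nabla u I x) (tpow ns \<gamma>)"

text \<open>
  As a \<open>d\<close>-simplex has nonempty interior, \<open>P\<^sub>k(T)\<close> is identified with the polynomial functions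
  on \<open>\<real>\<^sup>d\<close>.  On lower-dimensional sub-simplices polynomials are restricted.
\<close>

definition polys :: "nat \<Rightarrow> (real^'n \<Rightarrow> real) set" where
  "polys k = {u. \<exists>c. u = (\<lambda>x. \<Sum>a | (\<Sum>i\<in>UNIV. a i) \<le> k. c a * (\<Prod>i\<in>UNIV. (x $ i) ^ a i))}"

definition polys_on :: "nat \<Rightarrow> (real^'n) set \<Rightarrow> (real^'n \<Rightarrow> real) set" where
  "polys_on j F = (\<lambda>u. restrict u F) ` polys j"

definition bernstein ::
  "(real^'n \<Rightarrow> nat) \<Rightarrow> (nat \<Rightarrow> real^'n) \<Rightarrow> nat set \<Rightarrow> nat list \<Rightarrow> real^'n \<Rightarrow> real" where
  "bernstein gix v f \<mu> =
     (\<lambda>x\<in>convex hull (v ` f).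
        fact (sum_list \<mu>) / mfact \<mu> * (\<Prod>i<length \<mu>. bary v (vlist gix v f ! i) x ^ (\<mu> ! i)))"

definition linear_functional ::
  "nat \<Rightarrow> (real^'n) set \<Rightarrow> ((real^'n \<Rightarrow> real) \<Rightarrow> real) \<Rightarrow> bool" where
  "linear_functional j F b \<longleftrightarrow>
     (\<forall>p\<in>polys_on j F. \<forall>q\<in>polys_on j F. \<forall>s t.
        b (\<lambda>x\<in>F. s * p x + t * q x) = s * b p + t * b q)"

text \<open>
  \<open>b f \<mu>\<close>, \<open>\<mu> \<in> lattice l j\<close>, is the basis of \<open>P\<^sub>j(f)'\<close> dual to the Bernstein basis, for all \<open>f\<close> and \<open>j\<close>.
\<close>

definition bernstein_dual ::
  "(real^'n \<Rightarrow> nat) \<Rightarrow> (nat \<Rightarrow> real^'n) \<Rightarrow>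
   (nat set \<Rightarrow> nat list \<Rightarrow> (real^'n \<Rightarrow> real) \<Rightarrow> real) \<Rightarrow> bool" where
  "bernstein_dual gix v b \<longleftrightarrow>
     (\<forall>l\<le>CARD('n). \<forall>f\<in>subsimplices l {..CARD('n)}. \<forall>j. \<forall>\<mu>\<in>lattice l j.
        linear_functional j (convex hull (v ` f)) (b f \<mu>) \<and>
        (\<forall>\<nu>\<in>lattice l j. b f \<mu> (bernstein gix v f \<nu>) = (if \<mu> = \<nu> then 1 else 0)))"

definition function_basis :: "('a \<Rightarrow> real) set \<Rightarrow> 'i set \<Rightarrow> ('i \<Rightarrow> 'a \<Rightarrow> real) \<Rightarrow> bool" where
  "function_basis V A B \<longleftrightarrow>
     (\<forall>i\<in>A. B i \<in> V) \<and>
     (\<forall>c. (\<forall>x. (\<Sum>i\<in>A. c i * B i x) = 0) \<longrightarrow> (\<forall>i\<in>A. c i = 0)) \<and>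
     (\<forall>u\<in>V. \<exists>c. u = (\<lambda>x. \<Sum>i\<in>A. c i * B i x))"

definition dual_basis ::
  "('a \<Rightarrow> real) set \<Rightarrow> 'i set \<Rightarrow> ('i \<Rightarrow> ('a \<Rightarrow> real) \<Rightarrow> real) \<Rightarrow> ('i \<Rightarrow> 'a \<Rightarrow> real) \<Rightarrow> bool" where
  "dual_basis V A F B \<longleftrightarrow>
     function_basis V A B \<and> (\<forall>i\<in>A. \<forall>j\<in>A. F i (B j) = (if i = j then 1 else 0))"

text \<open>
  The functional attached to \<open>\<alpha>\<close> and a choice \<open>fr\<close> of frames: \<open>L\<^sup>\<alpha>\<close> for \<open>fr = tn_frame gix v\<close>
  and \<open>G\<^sup>\<alpha>\<close> for \<open>fr = frame N v\<close>.
\<close>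

definition dof ::
  "nat \<Rightarrow> (nat \<Rightarrow> nat) \<Rightarrow> (real^'n \<Rightarrow> nat) \<Rightarrow> (nat \<Rightarrow> real^'n) \<Rightarrow>
   (nat set \<Rightarrow> nat list \<Rightarrow> (real^'n \<Rightarrow> real) \<Rightarrow> real) \<Rightarrow> (nat set \<Rightarrow> (real^'n) list) \<Rightarrow>
   nat list \<Rightarrow> (real^'n \<Rightarrow> real) \<Rightarrow> real" where
  "dof k r gix v b fr \<alpha> u =
     (let f = owner CARD('n) k r \<alpha>
      in b f (comps gix v \<alpha> f)
           (restrict (frame_deriv (fr f) (comps gix v \<alpha> (opp v f)) u) (convex hull (v ` f))))"

definition Tmat ::
  "nat \<Rightarrow> (nat \<Rightarrow> nat) \<Rightarrow> (real^'n \<Rightarrow> nat) \<Rightarrow> (nat \<Rightarrow> real^'n) \<Rightarrow>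
   ((real^'n) set \<Rightarrow> nat \<Rightarrow> real^'n) \<Rightarrow> nat list \<Rightarrow> nat list \<Rightarrow> real" where
  "Tmat k r gix v Nhat \<alpha> \<beta> =
     (if \<exists>l\<le>CARD('n). \<exists>f\<in>subsimplices l {..CARD('n)}. \<exists>s.
           \<alpha> \<in> latticeS CARD('n) k r l f \<inter> latticeL CARD('n) k f s \<and>
           \<beta> \<in> latticeS CARD('n) k r l f \<inter> latticeL CARD('n) k f s \<and>
           comps gix v \<alpha> f = comps gix v \<beta> f
      then let f = owner CARD('n) k r \<alpha>; s = ldist \<alpha> f
           in fact s / mfact (comps gix v \<beta> (opp v f)) *
              tinner s (tsym s (tpow (tn_frame gix v f) (comps gix v \<alpha> (opp v f))))
                       (tsym s (tpow (frame Nhat v f) (comps gix v \<beta> (opp v f))))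
      else 0)"

end

theory Submission
  imports Defs "HOL-Combinatorics.Multiset_Permutations"
begin

text \<open>
  Everything reduces to one identity between functionals on \<open>P\<^sub>k(T)\<close>: for every lattice point
  \<open>\<alpha>\<close>, \<open>L\<^sup>\<alpha> = \<Sum>\<^sub>\<beta> T\<^sub>\<alpha>\<^sub>,\<^sub>\<beta> G\<^sup>\<beta>\<close> (lemma \<open>dof_tn_frame_eq\<close>).  Once it is known,
  evaluating it on the basis \<open>\<psi>\<close> gives \<open>T M = 1\<close> for the square matrix
  \<open>M\<^sub>\<beta>\<^sub>,\<^sub>\<gamma> = G\<^sup>\<beta>(\<psi>\<^sub>\<gamma>)\<close>.  A right inverse of a square matrix is also a left inverse, and
  \<open>M T = 1\<close> says exactly that \<open>\<phi>\<^sub>\<beta> = \<Sum>\<^sub>\<alpha> T\<^sub>\<alpha>\<^sub>,\<^sub>\<beta> \<psi>\<^sub>\<alpha>\<close> is dual to the functionals \<open>G\<close>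
  (lemma \<open>dual_basis_change\<close>).

  The identity is proved separately on the points attached to one sub-simplex \<open>f\<close>.  Fix \<open>\<alpha>\<close> with
  owner \<open>f\<close> and put \<open>s = dist(\<alpha>, f)\<close>.  Three facts meet:

  \<^item> Membership of \<open>\<alpha>\<close> in \<open>S\<^sub>l(f)\<close> depends only on \<open>s\<close> and \<open>\<alpha>\<^sub>f\<close>, because the distance to a
    face of \<open>f\<close> does (lemma \<open>latticeS_cong\<close>).  Since the sets \<open>S\<^sub>l(f)\<close> partition the lattice
    (locale \<open>smoothness_vector\<close>), the row of \<open>\<alpha>\<close> in the matrix \<open>T\<close> is therefore indexed by
    \<^emph>\<open>all\<close> multi-indices \<open>\<gamma>\<close> of order \<open>s\<close> on the vertices opposite to \<open>f\<close>
    (lemma \<open>bij_betw_comps_opp\<close>), with the same dual Bernstein functional \<open>b\<close> throughout the row.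

  \<^item> The vectors of \<open>n\<^sub>f\<close> lie in the normal plane of \<open>f\<close>: the gradient of \<open>\<lambda>\<^sub>i\<close>, \<open>i \<notin> f\<close>,
    is orthogonal to the edges of \<open>f\<close>, along which \<open>\<lambda>\<^sub>i\<close> vanishes, and projecting it onto the
    tangent space of \<open>f \<union> {i}\<close> does not change its products with these edges
    (lemma \<open>tn_vector_normal\<close>).  So each of them is the combination of the vectors of \<open>N\<^sub>f\<close>
    whose coefficients are the products with the vectors of the dual frame.

  \<^item> If vectors \<open>w\<^sub>1, \<dots>, w\<^sub>s\<close> are expanded in this way and \<open>A\<close> is a symmetric tensor, then
    \<open>A : (w\<^sub>1 \<otimes> \<dots> \<otimes> w\<^sub>s)\<close> is a sum over words in the indices of the frame; collecting the
    words with equal content \<open>\<gamma>\<close>, of which there are \<open>s!/\<gamma>!\<close>, produces the coefficients of the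
    matrix (lemma \<open>tinner_frame_change\<close>).  It is applied to \<open>A = \<nabla>\<^sup>s u(x)\<close>, symmetric since
    the partial derivatives of a polynomial commute.

  Hence \<open>\<partial>\<^sup>s u/\<partial>n\<^sub>f\<close> is on \<open>f\<close> a linear combination, with constant coefficients
  \<open>T\<^sub>\<alpha>\<^sub>,\<^sub>\<beta>\<close>, of the derivatives along \<open>N\<^sub>f\<close>.  All of these are polynomials of degree at most
  \<open>k - s = |\<alpha>\<^sub>f|\<close>, the degree for which the functional \<open>b\<close> is linear, so applying it yields the
  identity.
\<close>

section \<open>Dual bases under a change of functionals\<close>

text \<open>
  Gaussian elimination, one equation at a time: solve an equation for an unknown that occurs in it
  and substitute into the others.
\<close>

lemma underdetermined_system:
  fixes a :: "'e \<Rightarrow> 'x \<Rightarrow> real"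
  assumes "finite E" "finite X" "card E < card X"
  shows "\<exists>c. (\<exists>x\<in>X. c x \<noteq> 0) \<and> (\<forall>e\<in>E. (\<Sum>x\<in>X. a e x * c x) = 0)"
  using assms
proof (induction E arbitrary: X a)
  case empty
  then have "X \<noteq> {}" by auto
  then show ?case by (intro exI[of _ "\<lambda>_. 1"]) auto
next
  case (insert e E)
  show ?case
  proof (cases "\<exists>y\<in>X. a e y \<noteq> 0")
    case False
    have "card E < card X" using insert by simp
    with insert.IH[of X a] insert.prems obtain c
      where "\<exists>x\<in>X. c x \<noteq> 0" "\<forall>e\<in>E. (\<Sum>x\<in>X. a e x * c x) = 0" by blast
    then show ?thesis using False by (intro exI[of _ c]) auto
  next
    case True
    then obtain y where y: "y \<in> X" "a e y \<noteq> 0" by blast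
    have "card E < card (X - {y})" using insert y by simp
    with insert.IH[of "X - {y}" "\<lambda>f x. a f x - a f y * a e x / a e y"] insert.prems
    obtain c where c: "\<exists>x\<in>X - {y}. c x \<noteq> 0"
      and sol: "\<forall>f\<in>E. (\<Sum>x\<in>X - {y}. (a f x - a f y * a e x / a e y) * c x) = 0" by blast
    define z where "z = - (\<Sum>x\<in>X - {y}. a e x * c x) / a e y"
    define c' where "c' = c(y := z)"
    have split: "(\<Sum>x\<in>X. a f x * c' x) = a f y * z + (\<Sum>x\<in>X - {y}. a f x * c x)" for f
    proof -
      have "(\<Sum>x\<in>X. a f x * c' x) = a f y * c' y + (\<Sum>x\<in>X - {y}. a f x * c' x)"
        using insert.prems(1) y(1) by (rule sum.remove)
      also have "(\<Sum>x\<in>X - {y}. a f x * c' x) = (\<Sum>x\<in>X - {y}. a f x * c x)"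
        by (rule sum.cong) (auto simp: c'_def)
      finally show ?thesis by (simp add: c'_def)
    qed
    have "(\<Sum>x\<in>X. a e x * c' x) = 0" unfolding split using y(2) by (simp add: z_def)
    moreover have "(\<Sum>x\<in>X. a f x * c' x) = 0" if "f \<in> E" for f
    proof -
      have "(\<Sum>x\<in>X - {y}. (a f x - a f y * a e x / a e y) * c x) =
          (\<Sum>x\<in>X - {y}. a f x * c x) - a f y / a e y * (\<Sum>x\<in>X - {y}. a e x * c x)"
        by (simp add: sum_distrib_left sum_subtractf left_diff_distrib mult.assoc)
      then show ?thesis using sol that unfolding split by (simp add: z_def)
    qed
    moreover have "\<exists>x\<in>X. c' x \<noteq> 0" using c by (auto simp: c'_def)
    ultimately show ?thesis by (intro exI[of _ c']) auto
  qed
qed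

text \<open>
  Matrices here are indexed by an arbitrary finite set.  The system \<open>Q c = z e\<^sub>j\<close> in the unknowns
  \<open>c\<close> and \<open>z\<close> has one more unknown than equations, hence a nonzero solution; applying \<open>P\<close> gives
  \<open>c = z P e\<^sub>j\<close>.  So \<open>z \<noteq> 0\<close>, as otherwise \<open>c\<close> would vanish too, and dividing by \<open>z\<close> yields
  \<open>Q P e\<^sub>j = e\<^sub>j\<close>.
\<close>

lemma left_inverse_imp_right_inverse:
  fixes P Q :: "'i \<Rightarrow> 'i \<Rightarrow> real"
  assumes fin: "finite A"
    and PQ: "\<And>i j. i \<in> A \<Longrightarrow> j \<in> A \<Longrightarrow> (\<Sum>k\<in>A. P i k * Q k j) = (if i = j then 1 else 0)"
    and ij: "i \<in> A" "j \<in> A"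
  shows "(\<Sum>k\<in>A. Q i k * P k j) = (if i = j then 1 else 0)"
proof -
  have PQc: "c i = (\<Sum>k\<in>A. P i k * (\<Sum>l\<in>A. Q k l * c l))" if "i \<in> A" for c i
  proof -
    have "(\<Sum>k\<in>A. P i k * (\<Sum>l\<in>A. Q k l * c l)) = (\<Sum>k\<in>A. \<Sum>l\<in>A. P i k * Q k l * c l)"
      by (simp add: sum_distrib_left mult.assoc)
    also have "\<dots> = (\<Sum>l\<in>A. (\<Sum>k\<in>A. P i k * Q k l) * c l)"
      by (subst sum.swap) (simp only: sum_distrib_right)
    also have "\<dots> = (\<Sum>l\<in>A. if i = l then c l else 0)"
      using that by (intro sum.cong refl) (simp add: PQ)
    finally show ?thesis using that fin by simp
  qed
  \<comment> \<open>\<open>None\<close> stands for the additional unknown \<open>z\<close>\<close>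
  let ?X = "insert None (Some ` A)"
  let ?a = "\<lambda>k x. case x of None \<Rightarrow> (if k = j then - 1 else 0) | Some l \<Rightarrow> Q k l"
  have X: "(\<Sum>x\<in>?X. ?a k x * c x) = (if k = j then - c None else 0) + (\<Sum>l\<in>A. Q k l * c (Some l))" for k c
    using fin by (subst sum.insert) (auto simp: sum.reindex)
  have "card A < card ?X" using fin by (simp add: card_image)
  from underdetermined_system[OF fin _ this, of ?a] fin
  obtain c where c: "\<exists>x\<in>?X. c x \<noteq> 0" "\<forall>k\<in>A. (\<Sum>x\<in>?X. ?a k x * c x) = 0" by blast
  define z where "z = c None"
  have Qc: "(\<Sum>l\<in>A. Q k l * c (Some l)) = (if k = j then z else 0)" if "k \<in> A" for k
    using c(2) that unfolding X by (auto simp: z_def)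
  have Pz: "c (Some l) = P l j * z" if "l \<in> A" for l
  proof -
    have "c (Some l) = (\<Sum>k\<in>A. P l k * (if k = j then z else 0))"
      by (subst PQc[OF that, of "\<lambda>l. c (Some l)"]) (simp add: Qc cong: sum.cong_simp)
    also have "\<dots> = (\<Sum>k\<in>A. if k = j then P l k * z else 0)"
      by (intro sum.cong) auto
    finally show ?thesis using fin ij(2) by simp
  qed
  have z: "z \<noteq> 0"
  proof
    assume "z = 0"
    then have "c x = 0" if "x \<in> ?X" for x using that Pz by (auto simp: z_def)
    then show False using c(1) by blast
  qed
  have "(\<Sum>k\<in>A. Q i k * P k j) * z = (\<Sum>k\<in>A. Q i k * c (Some k))"
    by (simp add: Pz sum_distrib_right mult.assoc cong: sum.cong_simp)
  then show ?thesis using Qc[OF ij(1)] z by (auto split: if_splits)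
qed

text \<open>
  The matrix \<open>Q\<close> of the functionals \<open>G\<close> on the basis \<open>\<psi>\<close> is a two-sided inverse of the
  transition matrix \<open>P\<close>.  One side is the duality of \<open>\<phi>\<close>; the other expresses \<open>\<psi>\<close> through \<open>\<phi>\<close>,
  which makes \<open>\<phi>\<close> a spanning family.  Uniqueness holds because \<open>G\<close> reads off the coefficients
  with respect to \<open>\<phi>\<close>.
\<close>

lemma dual_basis_change:
  fixes L G :: "'i \<Rightarrow> ('a \<Rightarrow> real) \<Rightarrow> real"
  assumes fin: "finite A"
    and V: "\<And>c h. (\<And>i. i \<in> A \<Longrightarrow> h i \<in> V) \<Longrightarrow> (\<lambda>x. \<Sum>i\<in>A. c i * h i x) \<in> V"
    and G: "\<And>c h j. (\<And>i. i \<in> A \<Longrightarrow> h i \<in> V) \<Longrightarrow> j \<in> A \<Longrightarrow>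
              G j (\<lambda>x. \<Sum>i\<in>A. c i * h i x) = (\<Sum>i\<in>A. c i * G j (h i))"
    and LG: "\<And>i u. i \<in> A \<Longrightarrow> u \<in> V \<Longrightarrow> L i u = (\<Sum>j\<in>A. P i j * G j u)"
    and \<psi>: "dual_basis V A L \<psi>"
    and \<phi>: "\<And>j. j \<in> A \<Longrightarrow> \<phi> j = (\<lambda>x. \<Sum>i\<in>A. P i j * \<psi> i x)"
  shows "dual_basis V A G \<phi>"
    and "dual_basis V A G \<theta> \<Longrightarrow> j \<in> A \<Longrightarrow> \<theta> j = \<phi> j"
proof -
  define Q where "Q j i = G j (\<psi> i)" for j i
  have \<psi>V: "\<psi> i \<in> V" if "i \<in> A" for i
    using \<psi> that by (simp add: dual_basis_def function_basis_def)
  have PQ: "(\<Sum>k\<in>A. P i k * Q k j) = (if i = j then 1 else 0)" if "i \<in> A" "j \<in> A" for i j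
    using LG[OF that(1) \<psi>V[OF that(2)]] \<psi> that by (simp add: dual_basis_def Q_def)
  have QP: "(\<Sum>k\<in>A. Q i k * P k j) = (if i = j then 1 else 0)" if "i \<in> A" "j \<in> A" for i j
    using left_inverse_imp_right_inverse[OF fin PQ that] .
  have G\<phi>: "G i (\<phi> j) = (if i = j then 1 else 0)" if "i \<in> A" "j \<in> A" for i j
    using QP[OF that] G[of \<psi> i "\<lambda>i. P i j"] that \<psi>V by (simp add: \<phi> Q_def mult.commute)
  have \<phi>V: "\<phi> j \<in> V" if "j \<in> A" for j
    using that V[of \<psi> "\<lambda>i. P i j"] \<psi>V by (simp add: \<phi>)
  \<comment> \<open>the identity \<open>P Q = 1\<close> once more, now as a change of basis\<close>
  have \<psi>\<phi>: "\<psi> i x = (\<Sum>j\<in>A. Q j i * \<phi> j x)" if "i \<in> A" for i x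
  proof -
    have "(\<Sum>j\<in>A. Q j i * \<phi> j x) = (\<Sum>j\<in>A. \<Sum>k\<in>A. (P k j * Q j i) * \<psi> k x)"
      by (simp add: \<phi> sum_distrib_left mult_ac)
    also have "\<dots> = (\<Sum>k\<in>A. (\<Sum>j\<in>A. P k j * Q j i) * \<psi> k x)"
      by (subst sum.swap) (simp add: sum_distrib_right)
    also have "\<dots> = \<psi> i x"
      using that fin by (simp add: PQ if_distrib[of "\<lambda>t. t * _"] cong: if_cong)
    finally show ?thesis by simp
  qed
  have span: "\<exists>c. u = (\<lambda>x. \<Sum>j\<in>A. c j * \<phi> j x)" if "u \<in> V" for u
  proof -
    have "\<forall>u\<in>V. \<exists>c. u = (\<lambda>x. \<Sum>i\<in>A. c i * \<psi> i x)"
      using \<psi> unfolding dual_basis_def function_basis_def by (elim conjE)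
    from bspec[OF this that] obtain c where u: "u = (\<lambda>x. \<Sum>i\<in>A. c i * \<psi> i x)"
      by (rule exE)
    have "u x = (\<Sum>j\<in>A. (\<Sum>i\<in>A. c i * Q j i) * \<phi> j x)" for x
    proof -
      have "u x = (\<Sum>i\<in>A. \<Sum>j\<in>A. c i * Q j i * \<phi> j x)"
        unfolding u by (intro sum.cong refl) (simp add: \<psi>\<phi> sum_distrib_left mult.assoc)
      also have "\<dots> = (\<Sum>j\<in>A. \<Sum>i\<in>A. c i * Q j i * \<phi> j x)"
        by (rule sum.swap)
      finally show ?thesis by (simp only: sum_distrib_right)
    qed
    then show ?thesis by (intro exI[of _ "\<lambda>j. \<Sum>i\<in>A. c i * Q j i"]) (rule ext)
  qed
  have coeff: "G i (\<lambda>x. \<Sum>j\<in>A. c j * \<phi> j x) = c i" if "i \<in> A" for c i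
    using that fin by (simp add: G \<phi>V G\<phi> if_distrib[of "(*) _"] cong: if_cong)
  show "dual_basis V A G \<phi>"
    unfolding dual_basis_def function_basis_def
  proof (intro conjI ballI allI impI)
    fix c i assume z: "\<forall>x. (\<Sum>j\<in>A. c j * \<phi> j x) = 0" and i: "i \<in> A"
    have "c i = G i (\<lambda>x. \<Sum>j\<in>A. c j * \<phi> j x)"
      using coeff[OF i] by simp
    also have "(\<lambda>x. \<Sum>j\<in>A. c j * \<phi> j x) = (\<lambda>x. \<Sum>j\<in>A. 0 * \<phi> j x)"
      using z by simp
    finally show "c i = 0" using coeff[OF i, of "\<lambda>_. 0"] by simp
  qed (use \<phi>V span G\<phi> in auto)
  show "\<theta> j = \<phi> j" if \<theta>: "dual_basis V A G \<theta>" and j: "j \<in> A"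
  proof -
    have "\<theta> j \<in> V" using \<theta> j by (simp add: dual_basis_def function_basis_def)
    from span[OF this] obtain c where c: "\<theta> j = (\<lambda>x. \<Sum>i\<in>A. c i * \<phi> i x)"
      by (rule exE)
    have "c i = (if i = j then 1 else 0)" if "i \<in> A" for i
      using coeff[OF that, of c] \<theta> that j by (simp flip: c add: dual_basis_def)
    then have "\<theta> j = (\<lambda>x. \<Sum>i\<in>A. (if i = j then 1 else 0) * \<phi> i x)"
      unfolding c by (intro ext sum.cong) auto
    then show ?thesis using fin j by (simp add: if_distrib[of "\<lambda>t. t * _"] cong: if_cong)
  qed
qed

section \<open>Symmetric tensors in a change of frame\<close>

text \<open>
  Distributivity in the form needed for tensors: a product of \<open>s\<close> sums is a sum over the words of
  length \<open>s\<close>.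
\<close>

lemma sum_lists_prod:
  fixes f :: "nat \<Rightarrow> 'a \<Rightarrow> real"
  assumes "finite A"
  shows "(\<Sum>I | set I \<subseteq> A \<and> length I = s. \<Prod>j<s. f j (I ! j)) = (\<Prod>j<s. \<Sum>i\<in>A. f j i)"
proof (induction s arbitrary: f)
  case 0
  have "{I. set I \<subseteq> A \<and> length I = 0} = {[]}" by auto
  then show ?case by simp
next
  case (Suc s)
  let ?S = "\<lambda>s. {I. set I \<subseteq> A \<and> length I = s}"
  have S: "?S (Suc s) = (\<lambda>(i, I). i # I) ` (A \<times> ?S s)"
    by (auto simp: image_iff length_Suc_conv)
  have inj: "inj_on (\<lambda>(i, I). i # I) (A \<times> ?S s)" by (auto simp: inj_on_def)
  have "(\<Sum>I\<in>?S (Suc s). \<Prod>j<Suc s. f j (I ! j)) = (\<Sum>i\<in>A. \<Sum>I\<in>?S s. f 0 i * (\<Prod>j<s. f (Suc j) (I ! j)))"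
    unfolding S sum.reindex[OF inj]
    by (simp add: sum.cartesian_product prod.lessThan_Suc_shift case_prod_beta o_def del: prod.lessThan_Suc)
  also have "\<dots> = (\<Sum>i\<in>A. f 0 i) * (\<Prod>j<s. \<Sum>i\<in>A. f (Suc j) i)"
    using Suc.IH[of "\<lambda>j. f (Suc j)"] by (simp add: sum_distrib_left[symmetric] sum_distrib_right)
  finally show ?case by (simp add: prod.lessThan_Suc_shift del: prod.lessThan_Suc)
qed

lemma tinner_tprod:
  assumes "length ws = s" "length zs = s"
  shows "tinner s (tprod ws) (tprod zs) = (\<Prod>j<s. ws ! j \<bullet> zs ! j)"
  using assms sum_lists_prod[of UNIV "\<lambda>j i. (ws ! j) $ i * (zs ! j) $ i" s]
  by (simp add: tinner_def tprod_def inner_vec_def prod.distrib)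

lemma bij_betw_permute_list:
  assumes p: "p permutes {..<s}"
  shows "bij_betw (permute_list p) {I. set I \<subseteq> A \<and> length I = s} {I. set I \<subseteq> A \<and> length I = s}"
proof (rule bij_betw_byWitness[where f' = "permute_list (inv p)"])
  show "\<forall>I\<in>{I. set I \<subseteq> A \<and> length I = s}. permute_list (inv p) (permute_list p I) = I"
    using p by (auto simp: permute_list_compose[symmetric] permutes_inv permutes_inv_o)
  show "\<forall>I\<in>{I. set I \<subseteq> A \<and> length I = s}. permute_list p (permute_list (inv p) I) = I"
    using p by (auto simp: permute_list_compose[symmetric] permutes_inv permutes_inv_o)
qed (use p in \<open>auto simp: permutes_inv\<close>)

lemma tprod_permute_list:
  assumes "p permutes {..<s}" "length ws = s" "length I = s"
  shows "tprod ws (permute_list p I) = tprod (permute_list (inv p) ws) I"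
proof -
  have "tprod ws (permute_list p I) = (\<Prod>j<s. (ws ! j) $ (I ! p j))"
    using assms by (simp add: tprod_def permute_list_nth)
  also have "\<dots> = (\<Prod>j<s. (ws ! inv p j) $ (I ! p (inv p j)))"
    using prod.permute[OF permutes_inv[OF assms(1)], of "\<lambda>j. (ws ! j) $ (I ! p j)"] by (simp add: o_def)
  also have "\<dots> = tprod (permute_list (inv p) ws) I"
    using assms by (simp add: tprod_def permute_list_nth permutes_inv permutes_inverses)
  finally show ?thesis .
qed

lemma tsym_tprod:
  assumes "length ws = s" "length I = s"
  shows "tsym s (tprod ws) I = (\<Sum>p | p permutes {..<s}. tprod (permute_list p ws) I) / fact s"
  unfolding tsym_def using assms
  by (subst (2) sum_permutations_inverse) (simp add: tprod_permute_list cong: sum.cong_simp)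

lemma tinner_tsym_tprod:
  assumes "length ws = s" "length zs = s"
  shows "tinner s (tsym s (tprod ws)) (tsym s (tprod zs)) =
    (\<Sum>p | p permutes {..<s}. \<Sum>q | q permutes {..<s}.
       \<Prod>j<s. permute_list p ws ! j \<bullet> permute_list q zs ! j) / (fact s)\<^sup>2"
proof -
  have "tinner s (tsym s (tprod ws)) (tsym s (tprod zs)) =
      (\<Sum>I | length I = s. \<Sum>p | p permutes {..<s}. \<Sum>q | q permutes {..<s}.
         tprod (permute_list p ws) I * tprod (permute_list q zs) I) / (fact s)\<^sup>2"
    using assms by (simp add: tinner_def tsym_tprod sum_product power2_eq_square sum_divide_distrib)
  also have "\<dots> = (\<Sum>p | p permutes {..<s}. \<Sum>q | q permutes {..<s}.
      tinner s (tprod (permute_list p ws)) (tprod (permute_list q zs))) / (fact s)\<^sup>2"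
    unfolding tinner_def by (subst sum.swap, subst sum.swap, simp)
  finally show ?thesis using assms by (simp add: tinner_tprod)
qed

text \<open>
  Makes the coefficients of the transition matrix a function of the content of a word alone.
\<close>

lemma tinner_tsym_tprod_permute:
  fixes zs :: "(real^'n) list"
  assumes "length ws = s" "length zs = s" "r permutes {..<s}"
  shows "tinner s (tsym s (tprod ws)) (tsym s (tprod (permute_list r zs))) =
    tinner s (tsym s (tprod ws)) (tsym s (tprod zs))"
proof -
  have "(\<Sum>q | q permutes {..<s}. F (permute_list q (permute_list r zs))) =
      (\<Sum>q | q permutes {..<s}. F (permute_list q zs))" for F :: "(real^'n) list \<Rightarrow> real"
    using setum_permutations_compose_left[OF assms(3), of "\<lambda>q. F (permute_list q zs)"] assms(2)
    by (simp add: permute_list_compose cong: sum.cong_simp)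
  from this[of "\<lambda>L. \<Prod>j<s. permute_list p ws ! j \<bullet> L ! j" for p]
  show ?thesis using assms by (simp add: tinner_tsym_tprod)
qed

text \<open>
  Symmetry is stated through multisets of indices, so that no permutation has to be named when
  it is verified for an iterated derivative.
\<close>

definition symmetric_tensor :: "nat \<Rightarrow> ('n list \<Rightarrow> real) \<Rightarrow> bool" where
  "symmetric_tensor s A \<longleftrightarrow> (\<forall>I J. length I = s \<longrightarrow> mset I = mset J \<longrightarrow> A I = A J)"

lemma tinner_symmetric_permute:
  fixes A :: "'n::finite list \<Rightarrow> real"
  assumes A: "symmetric_tensor s A" and p: "p permutes {..<s}" and ws: "length ws = s"
  shows "tinner s A (tprod (permute_list p ws)) = tinner s A (tprod ws)"
proof -
  have ip: "inv p permutes {..<s}" "inv (inv p) = p"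
    using p by (simp_all add: permutes_inv permutes_inv_inv)
  have "tinner s A (tprod (permute_list p ws)) = (\<Sum>I | length I = s. A I * tprod ws (permute_list (inv p) I))"
    unfolding tinner_def using tprod_permute_list[OF ip(1) ws] ip(2) by (intro sum.cong) auto
  also have "\<dots> = (\<Sum>I | length I = s. A (permute_list (inv p) I) * tprod ws (permute_list (inv p) I))"
  proof (rule sum.cong)
    fix I :: "'n list" assume "I \<in> {I. length I = s}"
    then have "A I = A (permute_list (inv p) I)"
      using A[unfolded symmetric_tensor_def, rule_format, of I "permute_list (inv p) I"] ip(1) by simp
    then show "A I * tprod ws (permute_list (inv p) I) = A (permute_list (inv p) I) * tprod ws (permute_list (inv p) I)"
      by simp
  qed simp
  also have "\<dots> = tinner s A (tprod ws)"
    unfolding tinner_def using bij_betw_permute_list[OF ip(1), of UNIV]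
    by (intro sum.reindex_bij_betw[where g = "\<lambda>I. A I * tprod ws I"]) simp
  finally show ?thesis .
qed

text \<open>
  The word \<open>0\<dots>0 1\<dots>1 \<dots>\<close> with content \<open>\<gamma>\<close>: it lists the indices of the factors of a
  tensor power.
\<close>

definition power_word :: "nat list \<Rightarrow> nat list" where
  "power_word \<gamma> = concat (map2 replicate \<gamma> [0..<length \<gamma>])"

lemma tpow_map: "tpow (map F [0..<length \<gamma>]) \<gamma> = tprod (map F (power_word \<gamma>))"
  by (simp add: tpow_def power_word_def map_concat zip_map2 o_def case_prod_beta)

lemma count_power_word: "count (mset (power_word \<gamma>)) i = (if i < length \<gamma> then \<gamma> ! i else 0)"
proof -
  have "count (mset (concat (map2 replicate \<gamma> xs))) i = (\<Sum>j<length \<gamma>. if xs ! j = i then \<gamma> ! j else 0)"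
    if "length xs = length \<gamma>" for xs
    using that
  proof (induction \<gamma> arbitrary: xs)
    case (Cons g \<gamma>)
    then obtain x ys where xs: "xs = x # ys" by (cases xs) auto
    have "(\<Sum>j<length \<gamma>. if ys ! j = i then \<gamma> ! j else 0) = (\<Sum>j<length \<gamma>. if xs ! Suc j = i then (g # \<gamma>) ! Suc j else 0)"
      by (simp add: xs cong: if_cong)
    then show ?case using Cons.prems Cons.IH[of ys]
      by (simp add: xs sum.lessThan_Suc_shift del: sum.lessThan_Suc)
  qed simp
  from this[of "[0..<length \<gamma>]"]
  have "count (mset (power_word \<gamma>)) i = (\<Sum>j<length \<gamma>. if j = i then \<gamma> ! j else 0)"
    by (simp add: power_word_def cong: sum.cong_simp)
  then show ?thesis by simp
qed

lemma length_power_word: "length (power_word \<gamma>) = sum_list \<gamma>"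
proof -
  have "length (concat (map2 replicate \<gamma> xs)) = sum_list \<gamma>" if "length xs = length \<gamma>" for xs :: "nat list"
    using that
    by (induction \<gamma> arbitrary: xs) (auto simp: length_Suc_conv)
  then show ?thesis by (simp add: power_word_def)
qed

lemma set_power_word: "set (power_word \<gamma>) \<subseteq> {..<length \<gamma>}"
proof
  fix i assume "i \<in> set (power_word \<gamma>)"
  then have "count (mset (power_word \<gamma>)) i \<noteq> 0" using not_in_iff[of i "mset (power_word \<gamma>)"] by simp
  then show "i \<in> {..<length \<gamma>}" by (simp add: count_power_word split: if_splits)
qed

text \<open>
  The multinomial coefficient: the rearrangements of a word of content \<open>\<gamma>\<close>.
\<close>

lemma card_permutations_power_word:
  "real (card (permutations_of_multiset (mset (power_word \<gamma>)))) = fact (sum_list \<gamma>) / mfact \<gamma>"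
proof -
  let ?M = "mset (power_word \<gamma>)"
  have z: "count ?M i = 0" if "i \<notin> set (power_word \<gamma>)" for i
    using that not_in_iff[of i ?M] by simp
  have "(\<Prod>i\<in>set_mset ?M. fact (count ?M i)) = (\<Prod>i<length \<gamma>. fact (count ?M i) :: nat)"
    using set_power_word[of \<gamma>] by (intro prod.mono_neutral_left) (auto simp: z)
  then have "card (permutations_of_multiset ?M) * (\<Prod>i<length \<gamma>. fact (\<gamma> ! i)) = fact (sum_list \<gamma>)"
    using card_permutations_of_multiset_aux[of ?M]
    by (simp add: count_power_word length_power_word cong: prod.cong_simp)
  from arg_cong[OF this, of real]
  have "real (card (permutations_of_multiset ?M)) * (\<Prod>i<length \<gamma>. fact (\<gamma> ! i)) = fact (sum_list \<gamma>)"
    by (simp)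
  moreover have "mfact \<gamma> = (\<Prod>i<length \<gamma>. fact (\<gamma> ! i))"
    by (simp add: mfact_def prod.list_conv_set_nth atLeast0LessThan)
  moreover have "(\<Prod>i<length \<gamma>. fact (\<gamma> ! i) :: real) \<noteq> 0" by simp
  ultimately show ?thesis by (simp add: field_simps)
qed

text \<open>
  The origin of the factor \<open>s!/\<gamma>!\<close> in the transition matrix.
\<close>

lemma sum_words_by_content:
  fixes h :: "nat list \<Rightarrow> real"
  assumes h: "\<And>J J'. length J = s \<Longrightarrow> mset J = mset J' \<Longrightarrow> h J = h J'"
  shows "(\<Sum>J | set J \<subseteq> {..<p} \<and> length J = s. h J) =
    (\<Sum>\<gamma> | length \<gamma> = p \<and> sum_list \<gamma> = s. fact s / mfact \<gamma> * h (power_word \<gamma>))"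
proof -
  let ?S = "{J. set J \<subseteq> {..<p} \<and> length J = s}" and ?\<Gamma> = "{\<gamma>. length \<gamma> = p \<and> sum_list \<gamma> = s}"
  define content where "content J = map (count (mset J)) [0..<p]" for J :: "nat list"
  have fin\<Gamma>: "finite ?\<Gamma>"
  proof (rule finite_subset)
    show "?\<Gamma> \<subseteq> {\<gamma>. set \<gamma> \<subseteq> {..s} \<and> length \<gamma> = p}" by (auto intro: member_le_sum_list)
  qed (rule finite_lists_length_eq, simp)
  have content: "content J \<in> ?\<Gamma>" if "J \<in> ?S" for J
  proof -
    have "sum_list (content J) = (\<Sum>i<p. count (mset J) i)"
      by (simp add: content_def interv_sum_list_conv_sum_set_nat atLeast0LessThan)
    also have "\<dots> = (\<Sum>i\<in>set_mset (mset J). count (mset J) i)"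
      using that by (intro sum.mono_neutral_right) (auto simp: not_in_iff[symmetric])
    also have "\<dots> = s"
      using that by (simp only: size_multiset_overloaded_eq[symmetric]) simp
    finally show ?thesis by (simp add: content_def)
  qed
  have fibre: "{J. J \<in> ?S \<and> content J = \<gamma>} = permutations_of_multiset (mset (power_word \<gamma>))"
    if \<gamma>: "\<gamma> \<in> ?\<Gamma>" for \<gamma>
  proof (intro equalityI subsetI)
    fix J assume J: "J \<in> {J. J \<in> ?S \<and> content J = \<gamma>}"
    have "count (mset J) i = count (mset (power_word \<gamma>)) i" for i
      using J by (auto simp: count_power_word content_def not_in_iff[symmetric])
    then show "J \<in> permutations_of_multiset (mset (power_word \<gamma>))"
      by (auto simp: permutations_of_multiset_def intro: multiset_eqI)
  next
    fix J assume "J \<in> permutations_of_multiset (mset (power_word \<gamma>))"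
    then have J: "mset J = mset (power_word \<gamma>)" by (simp add: permutations_of_multiset_def)
    have "content J = \<gamma>"
      unfolding content_def J using \<gamma> by (intro nth_equalityI) (auto simp: count_power_word)
    moreover have "length J = s" "set J \<subseteq> {..<p}"
      using mset_eq_length[OF J] mset_eq_setD[OF J] set_power_word[of \<gamma>] \<gamma>
      by (auto simp: length_power_word)
    ultimately show "J \<in> {J. J \<in> ?S \<and> content J = \<gamma>}" by simp
  qed
  have "(\<Sum>J\<in>?S. h J) = (\<Sum>\<gamma>\<in>?\<Gamma>. \<Sum>J | J \<in> ?S \<and> content J = \<gamma>. h J)"
    using content by (intro sum.group[symmetric] fin\<Gamma>) (auto simp: finite_lists_length_eq)
  also have "\<dots> = (\<Sum>\<gamma>\<in>?\<Gamma>. fact s / mfact \<gamma> * h (power_word \<gamma>))"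
  proof (rule sum.cong)
    fix \<gamma> assume \<gamma>: "\<gamma> \<in> ?\<Gamma>"
    have "(\<Sum>J | J \<in> ?S \<and> content J = \<gamma>. h J) =
        (\<Sum>J\<in>permutations_of_multiset (mset (power_word \<gamma>)). h (power_word \<gamma>))"
      unfolding fibre[OF \<gamma>] using \<gamma>
      by (intro sum.cong h[symmetric]) (auto simp: permutations_of_multiset_def length_power_word)
    then show "(\<Sum>J | J \<in> ?S \<and> content J = \<gamma>. h J) = fact s / mfact \<gamma> * h (power_word \<gamma>)"
      using \<gamma> by (simp add: card_permutations_power_word)
  qed simp
  finally show ?thesis .
qed

lemma tinner_expand_frame:
  fixes A :: "'n::finite list \<Rightarrow> real" and E E' :: "nat \<Rightarrow> real^'n"
  assumes zs: "length zs = s" "\<And>w. w \<in> set zs \<Longrightarrow> w = (\<Sum>i<p. (w \<bullet> E' i) *\<^sub>R E i)"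
  shows "(\<Sum>J | set J \<subseteq> {..<p} \<and> length J = s.
            (\<Prod>j<s. zs ! j \<bullet> E' (J ! j)) * tinner s A (tprod (map E J))) = tinner s A (tprod zs)"
proof -
  let ?S = "{J. set J \<subseteq> {..<p} \<and> length J = s}"
  have "(\<Sum>J\<in>?S. (\<Prod>j<s. zs ! j \<bullet> E' (J ! j)) * tinner s A (tprod (map E J))) =
      (\<Sum>J\<in>?S. \<Sum>I | length I = s. A I * (\<Prod>j<s. (zs ! j \<bullet> E' (J ! j)) * E (J ! j) $ (I ! j)))"
    by (rule sum.cong) (auto simp: tinner_def tprod_def sum_distrib_left prod.distrib mult_ac)
  also have "\<dots> = (\<Sum>I | length I = s. A I * (\<Prod>j<s. \<Sum>i<p. (zs ! j \<bullet> E' i) * E i $ (I ! j)))"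
    using sum_lists_prod[OF finite_lessThan[of p], of "\<lambda>j i. (zs ! j \<bullet> E' i) * E i $ (I ! j)" s for I]
    by (subst sum.swap) (simp add: sum_distrib_left[symmetric])
  also have "\<dots> = tinner s A (tprod zs)"
  proof -
    have "(\<Sum>i<p. (zs ! j \<bullet> E' i) * E i $ c) = (zs ! j) $ c" if "j < s" for j c
      using arg_cong[OF zs(2)[of "zs ! j"], of "\<lambda>w. w $ c"] that zs(1) by simp
    then show ?thesis using zs(1) by (simp add: tinner_def tprod_def cong: prod.cong_simp)
  qed
  finally show ?thesis .
qed

text \<open>
  The coefficient at \<open>\<gamma>\<close> and the value of \<open>A\<close> depend only on the content of a word, so the right
  hand side is a sum over all words \<open>J\<close> of length \<open>s\<close>.  There the two symmetrisations are
  averages over permutations \<open>p\<close> and \<open>q\<close> of the slots.  Reindexing \<open>J\<close> by \<open>q\<close> removes \<open>q\<close>,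
  because \<open>A\<close> is symmetric; what remains is the expansion of \<open>A\<close> on the vectors permuted by
  \<open>p\<close>, which by symmetry does not depend on \<open>p\<close>.  Averaging one and the same number changes
  nothing.
\<close>

lemma tinner_frame_change:
  fixes A :: "'n::finite list \<Rightarrow> real" and E E' :: "nat \<Rightarrow> real^'n"
  assumes A: "symmetric_tensor s A" and ws: "length ws = s"
    and exp: "\<And>w. w \<in> set ws \<Longrightarrow> w = (\<Sum>i<p. (w \<bullet> E' i) *\<^sub>R E i)"
  shows "tinner s A (tprod ws) =
    (\<Sum>\<gamma> | length \<gamma> = p \<and> sum_list \<gamma> = s.
       fact s / mfact \<gamma> * tinner s (tsym s (tprod ws)) (tsym s (tpow (map E' [0..<p]) \<gamma>)) *
       tinner s A (tpow (map E [0..<p]) \<gamma>))"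
proof -
  let ?S = "{J. set J \<subseteq> {..<p} \<and> length J = s}" and ?P = "{q. q permutes {..<s}}"
  \<comment> \<open>the coefficient and the value of \<open>A\<close> attached to a word \<open>J\<close>\<close>
  define X where "X J = tinner s (tsym s (tprod ws)) (tsym s (tprod (map E' J)))" for J
  define a where "a J = tinner s A (tprod (map E J))" for J
  have inv: "X (permute_list q J) = X J" "a (permute_list q J) = a J" if "q permutes {..<s}" "length J = s" for q J
    using that A ws
    by (simp_all add: X_def a_def permute_list_map[symmetric] tinner_tsym_tprod_permute tinner_symmetric_permute)
  have h: "X J * a J = X J' * a J'" if J: "length J = s" "mset J = mset J'" for J J'
  proof -
    obtain q where q: "q permutes {..<length J'}" "permute_list q J' = J"
      using J(2) by (rule mset_eq_permutation)
    have "length J' = s" using J mset_eq_length[OF J(2)] by simp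
    then show ?thesis using inv[of q J'] q by simp
  qed
  have XP: "X J = (\<Sum>p\<in>?P. \<Sum>q\<in>?P. \<Prod>j<s. permute_list p ws ! j \<bullet> E' (permute_list q J ! j)) / (fact s)\<^sup>2"
    if "length J = s" for J
    using that ws by (simp add: X_def tinner_tsym_tprod permute_list_map cong: sum.cong_simp)
  have inner: "(\<Sum>J\<in>?S. (\<Prod>j<s. permute_list p ws ! j \<bullet> E' (permute_list q J ! j)) * a J) = tinner s A (tprod ws)"
    if p: "p permutes {..<s}" and q: "q permutes {..<s}" for p q
  proof -
    have "(\<Sum>J\<in>?S. (\<Prod>j<s. permute_list p ws ! j \<bullet> E' (permute_list q J ! j)) * a J) =
        (\<Sum>J\<in>?S. (\<Prod>j<s. permute_list p ws ! j \<bullet> E' (permute_list q J ! j)) * a (permute_list q J))"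
      using inv(2)[OF q] by (intro sum.cong) auto
    also have "\<dots> = (\<Sum>J\<in>?S. (\<Prod>j<s. permute_list p ws ! j \<bullet> E' (J ! j)) * a J)"
      by (rule sum.reindex_bij_betw[OF bij_betw_permute_list[OF q]])
    also have "\<dots> = tinner s A (tprod (permute_list p ws))"
      unfolding a_def using ws p exp by (intro tinner_expand_frame) auto
    finally show ?thesis by (simp add: tinner_symmetric_permute[OF A p ws])
  qed
  have "(\<Sum>J\<in>?S. X J * a J) = (\<Sum>J\<in>?S. \<Sum>p\<in>?P. \<Sum>q\<in>?P.
      (\<Prod>j<s. permute_list p ws ! j \<bullet> E' (permute_list q J ! j)) * a J) / (fact s)\<^sup>2"
    by (simp add: XP sum_distrib_right sum_divide_distrib cong: sum.cong_simp)
  also have "\<dots> = (\<Sum>p\<in>?P. \<Sum>q\<in>?P. \<Sum>J\<in>?S.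
      (\<Prod>j<s. permute_list p ws ! j \<bullet> E' (permute_list q J ! j)) * a J) / (fact s)\<^sup>2"
    by (subst sum.swap, subst sum.swap, simp)
  also have "\<dots> = (\<Sum>p\<in>?P. \<Sum>q\<in>?P. tinner s A (tprod ws)) / (fact s)\<^sup>2"
    by (simp add: inner cong: sum.cong_simp)
  also have "\<dots> = tinner s A (tprod ws)"
    by (simp add: card_permutations[of _ s] power2_eq_square)
  finally have "tinner s A (tprod ws) = (\<Sum>J\<in>?S. X J * a J)" ..
  also have "\<dots> = (\<Sum>\<gamma> | length \<gamma> = p \<and> sum_list \<gamma> = s. fact s / mfact \<gamma> * (X (power_word \<gamma>) * a (power_word \<gamma>)))"
    by (rule sum_words_by_content) (rule h)
  also have "\<dots> = (\<Sum>\<gamma> | length \<gamma> = p \<and> sum_list \<gamma> = s.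
       fact s / mfact \<gamma> * tinner s (tsym s (tprod ws)) (tsym s (tpow (map E' [0..<p]) \<gamma>)) *
       tinner s A (tpow (map E [0..<p]) \<gamma>))"
    by (rule sum.cong) (auto simp: X_def a_def tpow_map)
  finally show ?thesis .
qed

section \<open>Partial derivatives of polynomials\<close>

abbreviation monomial :: "('n \<Rightarrow> nat) \<Rightarrow> real^'n \<Rightarrow> real" where
  "monomial a \<equiv> (\<lambda>x. \<Prod>i\<in>UNIV. (x $ i) ^ a i)"

abbreviation partial :: "'n \<Rightarrow> (real^'n \<Rightarrow> real) \<Rightarrow> real^'n \<Rightarrow> real" where
  "partial i u \<equiv> (\<lambda>x. frechet_derivative u (at x) (axis i 1))"

lemma finite_exponents: "finite {a :: 'n::finite \<Rightarrow> nat. (\<Sum>i\<in>UNIV. a i) \<le> k}"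
proof (rule finite_subset)
  show "{a :: 'n \<Rightarrow> nat. (\<Sum>i\<in>UNIV. a i) \<le> k} \<subseteq> Pi\<^sub>E UNIV (\<lambda>_. {..k})"
  proof
    fix a :: "'n \<Rightarrow> nat" assume "a \<in> {a. (\<Sum>i\<in>UNIV. a i) \<le> k}"
    then have "a i \<le> k" for i
      using member_le_sum[of i UNIV a] by simp
    then show "a \<in> Pi\<^sub>E UNIV (\<lambda>_. {..k})" by (simp add: PiE_UNIV_domain)
  qed
qed (simp add: finite_PiE)

lemma monomial_in_polys: "(\<Sum>i\<in>UNIV. a i) \<le> k \<Longrightarrow> (\<lambda>x. c * monomial a x) \<in> polys k"
  unfolding polys_def
  by (rule CollectI, rule exI[of _ "\<lambda>a'. if a' = a then c else 0"])
     (simp add: if_distrib[of "\<lambda>t. t * _"] finite_exponents cong: if_cong)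

lemma polys_sum:
  assumes "\<And>i. i \<in> S \<Longrightarrow> u i \<in> polys k"
  shows "(\<lambda>x. \<Sum>i\<in>S. c i * u i x) \<in> polys k"
proof -
  have "\<exists>e. u i = (\<lambda>x. \<Sum>a | (\<Sum>i\<in>UNIV. a i) \<le> k. e a * monomial a x)" if "i \<in> S" for i
    using assms[OF that] unfolding polys_def by blast
  then have "\<forall>i\<in>S. \<exists>e. u i = (\<lambda>x. \<Sum>a | (\<Sum>i\<in>UNIV. a i) \<le> k. e a * monomial a x)" by blast
  from bchoice[OF this] obtain e
    where e: "\<And>i. i \<in> S \<Longrightarrow> u i = (\<lambda>x. \<Sum>a | (\<Sum>i\<in>UNIV. a i) \<le> k. e i a * monomial a x)"
    by blast
  have "(\<lambda>x. \<Sum>i\<in>S. c i * u i x) =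
      (\<lambda>x. \<Sum>a | (\<Sum>i\<in>UNIV. a i) \<le> k. (\<Sum>i\<in>S. c i * e i a) * monomial a x)"
  proof
    fix x
    have "(\<Sum>i\<in>S. c i * u i x) = (\<Sum>i\<in>S. \<Sum>a | (\<Sum>i\<in>UNIV. a i) \<le> k. c i * e i a * monomial a x)"
      by (rule sum.cong) (simp_all add: e sum_distrib_left mult.assoc)
    also have "\<dots> = (\<Sum>a | (\<Sum>i\<in>UNIV. a i) \<le> k. \<Sum>i\<in>S. c i * e i a * monomial a x)"
      by (rule sum.swap)
    finally show "(\<Sum>i\<in>S. c i * u i x) =
        (\<Sum>a | (\<Sum>i\<in>UNIV. a i) \<le> k. (\<Sum>i\<in>S. c i * e i a) * monomial a x)"
      by (simp only: sum_distrib_right)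
  qed
  then show ?thesis unfolding polys_def mem_Collect_eq
    by (rule exI[where x = "\<lambda>a. \<Sum>i\<in>S. c i * e i a"])
qed

lemma zero_in_polys: "(\<lambda>x. 0) \<in> polys k"
  using polys_sum[of "{}"] by simp

lemma polys_cases:
  assumes "u \<in> polys k"
  obtains c where "u = (\<lambda>x. \<Sum>a | (\<Sum>i\<in>UNIV. a i) \<le> k. c a * monomial a x)"
  using assms unfolding polys_def by blast

lemma monomial_has_derivative:
  "(monomial a has_derivative
     (\<lambda>h. \<Sum>i\<in>UNIV. (of_nat (a i) * h $ i * (x $ i) ^ (a i - 1)) * (\<Prod>j\<in>UNIV - {i}. (x $ j) ^ a j))) (at x)"
  by (rule has_derivative_prod)
     (auto intro!: derivative_eq_intros bounded_linear_imp_has_derivative)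

lemma partial_monomial:
  fixes a :: "'n::finite \<Rightarrow> nat"
  shows "partial i (monomial a) = (\<lambda>x. real (a i) * monomial (a(i := a i - 1)) x)"
proof
  fix x :: "real^'n"
  have "partial i (monomial a) x =
      (\<Sum>l\<in>UNIV. (of_nat (a l) * axis i 1 $ l * (x $ l) ^ (a l - 1)) * (\<Prod>j\<in>UNIV - {l}. (x $ j) ^ a j))"
    using frechet_derivative_at[OF monomial_has_derivative[of a x], symmetric] by simp
  also have "\<dots> = (\<Sum>l\<in>UNIV. if l = i then of_nat (a i) * (x $ i) ^ (a i - 1) * (\<Prod>j\<in>UNIV - {i}. (x $ j) ^ a j) else 0)"
    by (rule sum.cong) (auto simp: axis_def)
  also have "\<dots> = real (a i) * monomial (a(i := a i - 1)) x"
    by (simp add: prod.remove[of UNIV i] cong: prod.cong_simp)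
  finally show "partial i (monomial a) x = real (a i) * monomial (a(i := a i - 1)) x" .
qed

lemma monomial_differentiable: "monomial a differentiable at x"
  using monomial_has_derivative[of a x] by (auto simp: differentiable_def)

lemma partial_sum:
  assumes "\<And>j x. j \<in> S \<Longrightarrow> u j differentiable at x"
  shows "partial i (\<lambda>x. \<Sum>j\<in>S. c j * u j x) = (\<lambda>x. \<Sum>j\<in>S. c j * partial i (u j) x)"
proof
  fix x
  have "((\<lambda>x. \<Sum>j\<in>S. c j * u j x) has_derivative (\<lambda>h. \<Sum>j\<in>S. c j * frechet_derivative (u j) (at x) h)) (at x)"
    by (intro has_derivative_sum has_derivative_mult_right iffD1[OF frechet_derivative_works] assms)
  from frechet_derivative_at[OF this, symmetric]
  show "partial i (\<lambda>x. \<Sum>j\<in>S. c j * u j x) x = (\<Sum>j\<in>S. c j * partial i (u j) x)" by simp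
qed

lemma polys_differentiable:
  assumes "u \<in> polys k" shows "u differentiable at x"
proof -
  obtain c where u: "u = (\<lambda>x. \<Sum>a | (\<Sum>i\<in>UNIV. a i) \<le> k. c a * monomial a x)"
    using assms by (rule polys_cases)
  show ?thesis
    unfolding u
    by (rule differentiable_sum[OF finite_exponents])
       (rule ballI, rule differentiable_mult[OF differentiable_const monomial_differentiable])
qed

lemma polys_partial:
  fixes u :: "real^'n \<Rightarrow> real"
  assumes "u \<in> polys k" shows "partial i u \<in> polys (k - 1)"
proof -
  obtain c where u: "u = (\<lambda>x. \<Sum>a | (\<Sum>i\<in>UNIV. a i) \<le> k. c a * monomial a x)"
    using assms by (rule polys_cases)
  have "partial i u = (\<lambda>x. \<Sum>a | (\<Sum>i\<in>UNIV. a i) \<le> k. c a * (real (a i) * monomial (a(i := a i - 1)) x))"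
    unfolding u by (subst partial_sum) (simp_all only: monomial_differentiable fun_cong[OF partial_monomial])
  moreover have "(\<lambda>x. real (a i) * monomial (a(i := a i - 1)) x) \<in> polys (k - 1)"
    if "(\<Sum>i\<in>UNIV. a i) \<le> k" for a :: "'n \<Rightarrow> nat"
  proof (cases "a i = 0")
    case True
    then show ?thesis by (simp add: zero_in_polys)
  next
    case False
    have "(\<Sum>l\<in>UNIV. (a(i := a i - 1)) l) = (\<Sum>l\<in>UNIV. a l) - 1"
      using False by (simp add: sum.remove[of UNIV i] cong: sum.cong_simp)
    then show ?thesis using that by (intro monomial_in_polys) simp
  qed
  ultimately show ?thesis by (simp only:) (rule polys_sum, simp)
qed

text \<open>
  Commutation is read off from the explicit action on monomials.
\<close>

lemma partial_commute:
  fixes u :: "real^'n \<Rightarrow> real"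
  assumes "u \<in> polys k" shows "partial i (partial j u) = partial j (partial i u)"
proof -
  obtain c where u: "u = (\<lambda>x. \<Sum>a | (\<Sum>i\<in>UNIV. a i) \<le> k. c a * monomial a x)"
    using assms by (rule polys_cases)
  have two: "partial p (partial q u) = (\<lambda>x. \<Sum>a | (\<Sum>i\<in>UNIV. a i) \<le> k.
      (c a * real (a q) * real ((a(q := a q - 1)) p)) * monomial (a(q := a q - 1, p := (a(q := a q - 1)) p - 1)) x)" for p q
  proof -
    have "partial q u = (\<lambda>x. \<Sum>a | (\<Sum>i\<in>UNIV. a i) \<le> k. (c a * real (a q)) * monomial (a(q := a q - 1)) x)"
      unfolding u by (subst partial_sum) (simp_all only: monomial_differentiable fun_cong[OF partial_monomial] mult.assoc)
    then show ?thesis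
      by (simp only:) (subst partial_sum, simp_all only: monomial_differentiable fun_cong[OF partial_monomial] mult.assoc)
  qed
  show ?thesis
    unfolding two by (cases "i = j") (auto simp: fun_upd_twist mult_ac intro!: sum.cong)
qed

lemma nabla_in_polys: "u \<in> polys k \<Longrightarrow> nabla u I \<in> polys (k - length I)"
proof (induction I)
  case (Cons i I)
  then show ?case using polys_partial[of "nabla u I" "k - length I" i] by simp
qed simp

lemma nabla_sum:
  assumes "\<And>j. j \<in> S \<Longrightarrow> u j \<in> polys k"
  shows "nabla (\<lambda>x. \<Sum>j\<in>S. c j * u j x) I = (\<lambda>x. \<Sum>j\<in>S. c j * nabla (u j) I x)"
proof (induction I)
  case (Cons i I)
  show ?case
    using polys_differentiable[OF nabla_in_polys[OF assms]]
    by (simp add: Cons.IH partial_sum)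
qed simp

text \<open>
  Bubbles one differentiation past the others; with it the symmetry of the iterated derivative is
  an induction over the list of indices.
\<close>

lemma nabla_move_front:
  assumes "u \<in> polys k"
  shows "nabla u (I @ i # J) = nabla u (i # I @ J)"
proof (induction I)
  case (Cons j I)
  have "nabla u ((j # I) @ i # J) = partial j (partial i (nabla u (I @ J)))"
    using Cons by simp
  also have "\<dots> = partial i (partial j (nabla u (I @ J)))"
    by (rule partial_commute[OF nabla_in_polys[OF assms]])
  finally show ?case by simp
qed simp

lemma nabla_symmetric:
  assumes "u \<in> polys k"
  shows "mset I = mset J \<Longrightarrow> nabla u I = nabla u J"
proof (induction I arbitrary: J)
  case (Cons i I)
  then have "i \<in> set J" by (metis list.set_intros(1) set_mset_mset)
  then obtain J1 J2 where J: "J = J1 @ i # J2" by (meson split_list)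
  with Cons have "nabla u I = nabla u (J1 @ J2)" by simp
  then show ?case unfolding J nabla_move_front[OF assms] by simp
qed simp

section \<open>The decomposition of the lattice\<close>

lemma ldist_Int_le: "ldist \<alpha> (e \<inter> f) \<le> ldist \<alpha> e + ldist \<alpha> f"
proof -
  have "{..<length \<alpha>} - e \<inter> f = ({..<length \<alpha>} - e) \<union> ({..<length \<alpha>} - f)" by auto
  then show ?thesis by (simp add: ldist_def sum_Un_nat)
qed

lemma ldist_empty: "\<alpha> \<in> lattice d k \<Longrightarrow> ldist \<alpha> {} = k"
  by (auto simp: ldist_def lattice_def sum_list_sum_nth atLeast0LessThan simp del: sum.lessThan_Suc)

lemma ldist_subset:
  assumes "e \<subseteq> f" "f \<subseteq> {..<length \<alpha>}"
  shows "ldist \<alpha> e = ldist \<alpha> f + (\<Sum>i\<in>f - e. \<alpha> ! i)"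
proof -
  have "{..<length \<alpha>} - e = ({..<length \<alpha>} - f) \<union> (f - e)" using assms by auto
  moreover have "finite f" using assms(2) finite_subset by blast
  moreover have "({..<length \<alpha>} - f) \<inter> (f - e) = {}" by auto
  ultimately show ?thesis
    using sum.union_disjoint[of "{..<length \<alpha>} - f" "f - e" "(!) \<alpha>"] by (simp add: ldist_def)
qed

text \<open>
  For a face \<open>e\<close> of \<open>f\<close>, the distance to \<open>e\<close> is the distance to \<open>f\<close> plus the entries on
  \<open>f - e\<close>.  So the conditions defining the set only see the entries on \<open>f\<close> and the distance to
  \<open>f\<close>.
\<close>

lemma latticeS_cong:
  assumes "\<alpha> \<in> lattice d k" "\<beta> \<in> lattice d k" "f \<subseteq> {..d}"
    and "ldist \<alpha> f = ldist \<beta> f" "\<And>i. i \<in> f \<Longrightarrow> \<alpha> ! i = \<beta> ! i"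
  shows "\<alpha> \<in> latticeS d k r l f \<longleftrightarrow> \<beta> \<in> latticeS d k r l f"
proof -
  have len: "length \<alpha> = Suc d" "length \<beta> = Suc d" using assms(1,2) by (simp_all add: lattice_def)
  have "ldist \<alpha> e = ldist \<beta> e" if "e \<subseteq> f" for e
  proof -
    have "(\<Sum>i\<in>f - e. \<alpha> ! i) = (\<Sum>i\<in>f - e. \<beta> ! i)" using assms(5) by (intro sum.cong) auto
    then show ?thesis
      using ldist_subset[of e f \<alpha>] ldist_subset[of e f \<beta>] that assms(3,4) len
      by (simp add: lessThan_Suc_atMost)
  qed
  then have "\<alpha> \<in> latticeD d k e t \<longleftrightarrow> \<beta> \<in> latticeD d k e t" if "e \<subseteq> f" for e t
    using that assms(1,2) by (simp add: latticeD_def)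
  then show ?thesis by (auto simp: latticeS_def subsimplices_def)
qed

text \<open>
  The conditions on the orders \<open>r\<close> ensure that every lattice point belongs to exactly one
  \<open>S\<^sub>l(f)\<close>, which is what makes the description of \<open>owner\<close> meaningful.
\<close>

locale smoothness_vector =
  fixes d k :: nat and r :: "nat \<Rightarrow> nat"
  assumes r_top: "r d = 0" and r_step: "\<And>l. l + 2 \<le> d \<Longrightarrow> 2 * r (l + 1) \<le> r l"
    and degree: "2 * r 0 + 1 \<le> k"
begin

lemma r_halves: "i < j \<Longrightarrow> j \<le> d \<Longrightarrow> 2 * r j \<le> r i"
proof (induction j)
  case (Suc j)
  have "2 * r (Suc j) \<le> r j"
    using r_top r_step[of j] Suc.prems by (cases "Suc j = d") auto
  then show ?case using Suc by (cases "i = j") auto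
qed simp

lemma r_antimono: "i \<le> j \<Longrightarrow> j \<le> d \<Longrightarrow> r j \<le> r i"
  using r_halves[of i j] by (cases "i = j") auto

text \<open>
  A point close to two sub-simplices is close to their intersection, the distances adding up.  As
  the orders at least double when the dimension drops, the point already lies in the ball around
  the smaller sub-simplex \<open>f \<inter> f'\<close>, which \<open>S\<^sub>l(f)\<close> excludes; and the intersection is not empty,
  because the distance to the empty set is \<open>k > 2 r\<^sub>0\<close>.  The doubling argument needs a proper
  face of \<open>f\<close>, so the case \<open>f \<subseteq> f'\<close> is separate: there \<open>f\<close> itself is an excluded face of
  \<open>f'\<close>.
\<close>

lemma latticeS_disjoint:
  assumes f: "f \<in> subsimplices l {..d}" "\<alpha> \<in> latticeS d k r l f"
    and f': "f' \<in> subsimplices l' {..d}" "\<alpha> \<in> latticeS d k r l' f'"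
    and l: "l \<le> l'" "l' \<le> d"
  shows "f = f'"
proof (rule ccontr)
  assume ne: "f \<noteq> f'"
  have fin: "finite f" "finite f'" and card: "card f = l + 1" "card f' = l' + 1"
    using f f' finite_subset by (auto simp: subsimplices_def)
  have \<alpha>: "\<alpha> \<in> lattice d k" "ldist \<alpha> f \<le> r l" "ldist \<alpha> f' \<le> r l'"
    using f(2) f'(2) by (auto simp: latticeS_def latticeD_def)
  have notS: "r i < ldist \<alpha> e" if "e \<subseteq> f" "card e = i + 1" "i < l" for e i
    using f(2) that \<alpha>(1) by (auto simp: latticeS_def latticeD_def subsimplices_def not_le)
  have notS': "r i < ldist \<alpha> e" if "e \<subseteq> f'" "card e = i + 1" "i < l'" for e i
    using f'(2) that \<alpha>(1) by (auto simp: latticeS_def latticeD_def subsimplices_def not_le)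
  show False
  proof (cases "f \<subseteq> f'")
    case True
    then have "card f < card f'" using ne fin by (intro psubset_card_mono) auto
    then show False using notS'[OF True card(1)] card \<alpha>(2) by simp
  next
    case False
    \<comment> \<open>only here is \<open>f \<inter> f'\<close> a proper face of \<open>f\<close>\<close>
    then have lt: "card (f \<inter> f') < card f" using fin by (intro psubset_card_mono) auto
    have dist: "ldist \<alpha> (f \<inter> f') \<le> 2 * r l"
      using ldist_Int_le[of \<alpha> f f'] \<alpha>(2,3) r_antimono[OF l] by simp
    show False
    proof (cases "card (f \<inter> f')")
      case 0
      then have "f \<inter> f' = {}" using fin by simp
      then have "k \<le> 2 * r l" using dist ldist_empty[OF \<alpha>(1)] by simp
      then show False using r_antimono[of 0 l] l degree by simp
    next
      case (Suc i)
      then have "i < l" using lt card by simp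
      then have "r i < ldist \<alpha> (f \<inter> f')" using notS[of "f \<inter> f'" i] Suc by simp
      then show False using dist r_halves[OF \<open>i < l\<close>] l by simp
    qed
  qed
qed

text \<open>
  Take a sub-simplex of least dimension whose ball contains the point; the simplex itself is a
  candidate.
\<close>

lemma latticeS_cover:
  assumes \<alpha>: "\<alpha> \<in> lattice d k"
  shows "\<exists>l\<le>d. \<exists>f\<in>subsimplices l {..d}. \<alpha> \<in> latticeS d k r l f"
proof -
  let ?P = "\<lambda>l. \<exists>f\<in>subsimplices l {..d}. \<alpha> \<in> latticeD d k f (r l)"
  have "ldist \<alpha> {..d} = 0"
    using \<alpha> by (simp add: ldist_def lattice_def lessThan_Suc_atMost)
  then have d: "?P d"
    using \<alpha> by (intro bexI[of _ "{..d}"]) (auto simp: latticeD_def subsimplices_def)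
  define l where "l = (LEAST l. ?P l)"
  have "?P l" "l \<le> d" unfolding l_def using d by (rule LeastI, rule Least_le)
  then obtain f where f: "f \<in> subsimplices l {..d}" "\<alpha> \<in> latticeD d k f (r l)" by blast
  have "\<alpha> \<notin> latticeD d k e (r i)" if "i < l" "e \<in> subsimplices i f" for i e
    using not_less_Least[of i ?P] that f(1) by (auto simp: l_def subsimplices_def)
  then have "\<alpha> \<in> latticeS d k r l f" using f(2) by (auto simp: latticeS_def)
  then show ?thesis using \<open>l \<le> d\<close> f(1) by blast
qed

lemma owner_eq:
  assumes "l \<le> d" "f \<in> subsimplices l {..d}" "\<alpha> \<in> latticeS d k r l f"
  shows "owner d k r \<alpha> = f"
  unfolding owner_def
proof (rule the_equality)
  fix f' assume "\<exists>l\<le>d. f' \<in> subsimplices l {..d} \<and> \<alpha> \<in> latticeS d k r l f'"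
  then obtain l' where "l' \<le> d" "f' \<in> subsimplices l' {..d}" "\<alpha> \<in> latticeS d k r l' f'" by blast
  then show "f' = f"
    using assms latticeS_disjoint[of f l \<alpha> f' l'] latticeS_disjoint[of f' l' \<alpha> f l]
    by (cases "l \<le> l'") auto
qed (use assms in blast)

lemma owner_cases:
  assumes "\<alpha> \<in> lattice d k"
  obtains l where "l \<le> d" "owner d k r \<alpha> \<in> subsimplices l {..d}" "\<alpha> \<in> latticeS d k r l (owner d k r \<alpha>)"
proof -
  obtain l f where f: "l \<le> d" "f \<in> subsimplices l {..d}" "\<alpha> \<in> latticeS d k r l f"
    using latticeS_cover[OF assms] by blast
  show ?thesis using that[of l] f owner_eq[OF f] by simp
qed

end

section \<open>Barycentric gradients and the normal plane\<close>

lemma orth_proj_works: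
  fixes S :: "(real^'n) set"
  assumes S: "subspace S"
  shows "orth_proj S x \<in> S" "x - orth_proj S x \<in> S\<^sup>\<bottom>"
proof -
  have "\<exists>!p. p \<in> S \<and> x - p \<in> S\<^sup>\<bottom>"
  proof (rule ex_ex1I)
    obtain y z where "y \<in> span S" "\<And>w. w \<in> span S \<Longrightarrow> orthogonal z w" "x = y + z"
      using orthogonal_subspace_decomp_exists by blast
    then show "\<exists>p. p \<in> S \<and> x - p \<in> S\<^sup>\<bottom>"
      using S by (intro exI[of _ y]) (auto simp: orthogonal_comp_def orthogonal_commute span_eq_iff[THEN iffD2])
  next
    fix p q assume p: "p \<in> S \<and> x - p \<in> S\<^sup>\<bottom>" and q: "q \<in> S \<and> x - q \<in> S\<^sup>\<bottom>"
    have "p - q \<in> S" using p q S by (simp add: subspace_diff)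
    moreover have "(x - q) - (x - p) \<in> S\<^sup>\<bottom>" using p q subspace_orthogonal_comp[of S] by (blast intro: subspace_diff)
    ultimately have "orthogonal (p - q) (p - q)" by (auto simp: orthogonal_comp_def)
    then show "p = q" by (simp add: orthogonal_def)
  qed
  from theI'[OF this] show "orth_proj S x \<in> S" "x - orth_proj S x \<in> S\<^sup>\<bottom>"
    unfolding orth_proj_def by auto
qed

locale simplex_vertices =
  fixes v :: "nat \<Rightarrow> real^'n"
  assumes inj_v: "inj_on v {..CARD('n)}" and independent_v: "\<not> affine_dependent (v ` {..CARD('n)})"
begin

text \<open>
  The coordinate \<open>\<lambda>\<^sub>i\<close> as an explicit affine function: the facet opposite to the vertex \<open>i\<close> spans
  a hyperplane that misses the vertex, and the equation of the hyperplane is rescaled to take the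
  value 1 there.
\<close>

lemma barycentric_functional:
  assumes i: "i \<le> CARD('n)"
  shows "\<exists>g c. \<forall>j\<le>CARD('n). g \<bullet> v j + c = (if j = i then 1 else 0)"
proof -
  let ?F = "v ` ({..CARD('n)} - {i})"
  have "\<not> affine_dependent ?F"
    using independent_v affine_dependent_subset[of ?F "v ` {..CARD('n)}"] by blast
  moreover have "card ?F = CARD('n)"
    using i by (subst card_image[OF inj_on_subset[OF inj_v]]) auto
  ultimately have "aff_dim ?F = int DIM(real^'n) - 1"
    using aff_dim_affine_independent[of ?F] by simp
  then obtain a \<beta> where H: "affine hull ?F = {x. a \<bullet> x = \<beta>}"
    using aff_dim_eq_hyperplane[of ?F] by auto
  have "v i \<notin> affine hull (v ` {..CARD('n)} - {v i})"
    using independent_v i by (simp add: affine_dependent_def)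
  moreover have "v ` {..CARD('n)} - {v i} = ?F"
    using inj_v i by (auto simp: inj_on_def)
  ultimately have "v i \<notin> affine hull ?F" by simp
  then have ne: "a \<bullet> v i - \<beta> \<noteq> 0" using H by simp
  have on: "a \<bullet> v j = \<beta>" if "j \<le> CARD('n)" "j \<noteq> i" for j
    using H that hull_inc[of "v j" ?F affine] by auto
  show ?thesis
  proof (intro exI allI impI)
    fix j assume j: "j \<le> CARD('n)"
    have "(a /\<^sub>R (a \<bullet> v i - \<beta>)) \<bullet> v j + (- \<beta> / (a \<bullet> v i - \<beta>)) = (a \<bullet> v j - \<beta>) / (a \<bullet> v i - \<beta>)"
      by (simp add: divide_inverse algebra_simps)
    then show "(a /\<^sub>R (a \<bullet> v i - \<beta>)) \<bullet> v j + (- \<beta> / (a \<bullet> v i - \<beta>)) = (if j = i then 1 else 0)"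
      using ne on j by simp
  qed
qed

lemma barycentric_coordinate_unique:
  assumes g: "\<And>j. j \<le> CARD('n) \<Longrightarrow> g \<bullet> v j + c = (if j = i then 1 else 0)" and i: "i \<le> CARD('n)"
    and C: "(\<Sum>j\<le>CARD('n). C j) = 1" "(\<Sum>j\<le>CARD('n). C j *\<^sub>R v j) = x"
  shows "C i = g \<bullet> x + c"
proof -
  have "g \<bullet> x + c = g \<bullet> (\<Sum>j\<le>CARD('n). C j *\<^sub>R v j) + (\<Sum>j\<le>CARD('n). C j) * c"
    using C by simp
  also have "\<dots> = (\<Sum>j\<le>CARD('n). C j * (g \<bullet> v j + c))"
    by (simp add: inner_sum_right sum_distrib_right sum.distrib distrib_left)
  also have "\<dots> = (\<Sum>j\<le>CARD('n). if j = i then C j else 0)"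
    by (intro sum.cong refl) (simp add: g)
  finally show ?thesis using i by simp
qed

lemma barycentric_coordinates_exist:
  "\<exists>C. (\<forall>j. j \<notin> {..CARD('n)} \<longrightarrow> C j = 0) \<and> (\<Sum>j\<le>CARD('n). C j) = 1 \<and> (\<Sum>j\<le>CARD('n). C j *\<^sub>R v j) = x"
proof -
  have "affine hull (v ` {..CARD('n)}) = UNIV"
    using independent_v inj_v by (intro affine_independent_span_eq) (auto simp: card_image)
  then obtain w where w: "sum w (v ` {..CARD('n)}) = 1" "(\<Sum>y\<in>v ` {..CARD('n)}. w y *\<^sub>R y) = x"
    using affine_hull_finite[of "v ` {..CARD('n)}"] by auto
  then show ?thesis
    by (intro exI[of _ "\<lambda>j. if j \<le> CARD('n) then w (v j) else 0"]) (simp add: sum.reindex[OF inj_v] o_def)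
qed

lemma bary_eq:
  assumes g: "\<And>j. j \<le> CARD('n) \<Longrightarrow> g \<bullet> v j + c = (if j = i then 1 else 0)" and i: "i \<le> CARD('n)"
  shows "bary v i x = g \<bullet> x + c"
proof -
  let ?P = "\<lambda>C. (\<forall>j. j \<notin> {..CARD('n)} \<longrightarrow> C j = 0) \<and> (\<Sum>j\<le>CARD('n). C j) = 1 \<and> (\<Sum>j\<le>CARD('n). C j *\<^sub>R v j) = x"
  have "\<exists>!C. ?P C"
  proof (rule ex_ex1I)
    fix C D assume C: "?P C" and D: "?P D"
    show "C = D"
    proof
      fix j show "C j = D j"
      proof (cases "j \<le> CARD('n)")
        case True
        then obtain h e where "\<forall>l\<le>CARD('n). h \<bullet> v l + e = (if l = j then 1 else 0)"
          using barycentric_functional by blast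
        then show ?thesis
          using C D True barycentric_coordinate_unique[of h e j] by metis
      qed (use C D in auto)
    qed
  qed (rule barycentric_coordinates_exist)
  from theI'[OF this] show ?thesis
    unfolding bary_def using barycentric_coordinate_unique[OF g i] by blast
qed

lemma grad_bary_eq:
  assumes g: "\<And>j. j \<le> CARD('n) \<Longrightarrow> g \<bullet> v j + c = (if j = i then 1 else 0)" and i: "i \<le> CARD('n)"
  shows "grad_bary v i = g"
proof -
  have "bary v i = (\<lambda>x. g \<bullet> x + c)" using bary_eq[OF g i] by auto
  then have der: "GDERIV (bary v i) x :> g" for x
    by (auto simp: gderiv_def inner_commute intro!: derivative_eq_intros)
  show ?thesis unfolding grad_bary_def
  proof (rule the_equality)
    fix h assume "\<forall>x. GDERIV (bary v i) x :> h"
    then have "(\<lambda>z. z \<bullet> h) = (\<lambda>z. z \<bullet> g)"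
      using der[of 0] by (auto simp: gderiv_def intro: has_derivative_unique)
    then show "h = g" by (metis inner_commute vector_eq_rdot)
  qed (use der in blast)
qed

text \<open>
  The coordinate \<open>\<lambda>\<^sub>i\<close> vanishes at all other vertices, hence is constant along the edges between
  them.
\<close>

lemma grad_bary_orthogonal:
  assumes "i \<le> CARD('n)" "a \<le> CARD('n)" "b \<le> CARD('n)" "a \<noteq> i" "b \<noteq> i"
  shows "grad_bary v i \<bullet> (v a - v b) = 0"
proof -
  obtain g c where g: "\<forall>j\<le>CARD('n). g \<bullet> v j + c = (if j = i then 1 else 0)"
    using barycentric_functional[OF assms(1)] by blast
  have "g \<bullet> v a + c = 0" "g \<bullet> v b + c = 0" using g assms by auto
  then show ?thesis using grad_bary_eq[of g c i] g assms(1) by (simp add: inner_diff_right)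
qed

text \<open>
  The projection of the gradient differs from the gradient by a vector orthogonal to the tangent
  space of \<open>f \<union> {i}\<close>, in particular to the edges of \<open>f\<close>.
\<close>

lemma tn_vector_normal:
  assumes f: "f \<subseteq> {..CARD('n)}" and i: "i \<in> opp v f"
  shows "tn_vector v f i \<in> normal_plane v f"
proof -
  let ?S = "tangent_space v (insert i f)"
  define w where "w = orth_proj ?S (grad_bary v i)"
  have "subspace ?S" by (simp add: tangent_space_def)
  then have w: "grad_bary v i - w \<in> ?S\<^sup>\<bottom>"
    unfolding w_def by (rule orth_proj_works)
  have "orthogonal w (v a - v b)" if "a \<in> f" "b \<in> f" for a b
  proof -
    have "v a - v b \<in> ?S" unfolding tangent_space_def using that by (intro span_base) auto
    then have "(v a - v b) \<bullet> (grad_bary v i - w) = 0"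
      using w by (simp add: orthogonal_comp_def orthogonal_def)
    moreover have "grad_bary v i \<bullet> (v a - v b) = 0"
      using that f i by (intro grad_bary_orthogonal) (auto simp: opp_def)
    ultimately show ?thesis by (simp add: orthogonal_def inner_diff_right inner_commute)
  qed
  then have "orthogonal w y" if "y \<in> tangent_space v f" for y
    using orthogonal_to_span[OF that[unfolded tangent_space_def], of w] by blast
  then have "w \<in> normal_plane v f"
    by (simp add: normal_plane_def orthogonal_comp_def orthogonal_commute)
  then show ?thesis
    unfolding tn_vector_def Let_def w_def[symmetric] normal_plane_def
    by (rule subspace_mul[OF subspace_orthogonal_comp])
qed

end

text \<open>
  Biorthogonality identifies the coefficients of an expansion.
\<close>

lemma normal_basis_expansion:
  assumes E: "normal_basis v f E" and p: "p = card (opp v f)"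
    and dual: "\<And>i j. i < p \<Longrightarrow> j < p \<Longrightarrow> E' i \<bullet> E j = (if i = j then 1 else 0)"
    and x: "x \<in> normal_plane v f"
  shows "x = (\<Sum>i<p. (x \<bullet> E' i) *\<^sub>R E i)"
proof -
  have "x \<in> span (E ` {..<p})" and inj: "inj_on E {..<p}" using E x p by (simp_all add: normal_basis_def)
  then obtain c where "x = (\<Sum>y\<in>E ` {..<p}. c y *\<^sub>R y)"
    by (auto simp: span_finite)
  then have x: "x = (\<Sum>j<p. c (E j) *\<^sub>R E j)" by (simp add: sum.reindex[OF inj])
  have "x \<bullet> E' i = c (E i)" if "i < p" for i
  proof -
    have "E' i \<bullet> x = (\<Sum>j<p. c (E j) * (E' i \<bullet> E j))"
      by (subst x) (simp add: inner_sum_right)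
    also have "\<dots> = (\<Sum>j<p. if j = i then c (E j) else 0)"
      using that by (intro sum.cong refl) (auto simp: dual)
    finally show ?thesis using that by (simp add: inner_commute)
  qed
  then show ?thesis using x by simp
qed

section \<open>The transition matrix between the two families of functionals\<close>

text \<open>
  Injectivity of the global numbering makes the ordered list of the vertices of a sub-simplex
  enumerate them without omission or repetition.
\<close>

locale indexed_simplex = simplex_vertices v for v :: "nat \<Rightarrow> real^'n" +
  fixes gix :: "real^'n \<Rightarrow> nat"
  assumes inj_gix: "inj_on (\<lambda>i. gix (v i)) {..CARD('n)}"
begin

lemma vlist:
  assumes f: "f \<subseteq> {..CARD('n)}"
  shows "set (vlist gix v f) = f" "distinct (vlist gix v f)" "length (vlist gix v f) = card f"
proof -
  interpret folding_insort_key "(\<le>)" "(<)" "{..CARD('n)}" "\<lambda>i. gix (v i)"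
    by unfold_locales (rule inj_gix)
  have "finite f" using f finite_subset by blast
  then show "set (vlist gix v f) = f" "distinct (vlist gix v f)" "length (vlist gix v f) = card f"
    using f set_sorted_key_list_of_set[OF f] length_sorted_key_list_of_set[OF f]
      distinct_if_distinct_map[OF distinct_sorted_key_list_of_set[OF f]]
    unfolding vlist_def sorted_key_list_of_set_dict by auto
qed

lemma opp_subset: "opp v f \<subseteq> {..CARD('n)}"
  by (auto simp: opp_def)

lemma length_comps: "f \<subseteq> {..CARD('n)} \<Longrightarrow> length (comps gix v \<alpha> f) = card f"
  by (simp add: comps_def vlist)

lemma sum_list_comps: "f \<subseteq> {..CARD('n)} \<Longrightarrow> sum_list (comps gix v \<alpha> f) = (\<Sum>i\<in>f. \<alpha> ! i)"
  by (simp add: comps_def vlist sum_list_distinct_conv_sum_set)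

lemma comps_eq_iff:
  "f \<subseteq> {..CARD('n)} \<Longrightarrow> comps gix v \<alpha> f = comps gix v \<beta> f \<longleftrightarrow> (\<forall>i\<in>f. \<alpha> ! i = \<beta> ! i)"
  by (simp add: comps_def vlist)

lemma sum_list_comps_opp:
  "length \<alpha> = Suc CARD('n) \<Longrightarrow> sum_list (comps gix v \<alpha> (opp v f)) = ldist \<alpha> f"
  by (simp add: sum_list_comps[OF opp_subset]) (simp add: ldist_def opp_def lessThan_Suc_atMost)

lemma sum_list_comps_add:
  assumes "length \<alpha> = Suc CARD('n)" "f \<subseteq> {..CARD('n)}"
  shows "sum_list (comps gix v \<alpha> f) + ldist \<alpha> f = sum_list \<alpha>"
proof -
  have "sum_list \<alpha> = (\<Sum>i\<le>CARD('n). \<alpha> ! i)"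
    using assms(1) by (simp add: sum_list_sum_nth atLeast0LessThan lessThan_Suc_atMost del: sum.lessThan_Suc)
  also have "\<dots> = (\<Sum>i\<in>f. \<alpha> ! i) + (\<Sum>i\<in>{..CARD('n)} - f. \<alpha> ! i)"
    using sum.subset_diff[OF assms(2), of "(!) \<alpha>"] by simp
  finally show ?thesis
    using assms by (simp add: sum_list_comps ldist_def lessThan_Suc_atMost)
qed

lemma comps_in_lattice:
  assumes "\<alpha> \<in> lattice CARD('n) k" "f \<in> subsimplices l {..CARD('n)}"
  shows "comps gix v \<alpha> f \<in> lattice l (k - ldist \<alpha> f)"
proof -
  have f: "f \<subseteq> {..CARD('n)}" "card f = l + 1" using assms(2) by (auto simp: subsimplices_def)
  then show ?thesis
    using assms(1) sum_list_comps_add[of \<alpha> f] by (auto simp: lattice_def length_comps)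
qed

text \<open>
  Identifies the nonzero entries in the row of \<open>\<alpha>\<close> of the transition matrix with the
  multi-indices on the opposite vertices: a lattice point consists of its entries on \<open>f\<close> and on the
  complement, and the only constraint is the total sum.
\<close>

lemma bij_betw_comps_opp:
  assumes \<alpha>: "\<alpha> \<in> lattice CARD('n) k" and f: "f \<subseteq> {..CARD('n)}"
  shows "bij_betw (\<lambda>\<beta>. comps gix v \<beta> (opp v f))
    {\<beta> \<in> lattice CARD('n) k. ldist \<beta> f = ldist \<alpha> f \<and> comps gix v \<beta> f = comps gix v \<alpha> f}
    {\<gamma>. length \<gamma> = card (opp v f) \<and> sum_list \<gamma> = ldist \<alpha> f}"
    (is "bij_betw ?c ?B ?\<Gamma>")
proof -
  have "inj_on ?c ?B"
  proof (rule inj_onI)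
    fix \<beta> \<beta>' assume \<beta>: "\<beta> \<in> ?B" "\<beta>' \<in> ?B" and eq: "?c \<beta> = ?c \<beta>'"
    have "\<beta> ! i = \<beta>' ! i" if "i \<le> CARD('n)" for i
    proof (cases "i \<in> f")
      case True
      have "comps gix v \<beta> f = comps gix v \<beta>' f" using \<beta> by simp
      then show ?thesis using comps_eq_iff[OF f] True by blast
    next
      case False
      then show ?thesis using eq that comps_eq_iff[OF opp_subset] by (simp add: opp_def)
    qed
    then show "\<beta> = \<beta>'" using \<beta> by (intro nth_equalityI) (auto simp: lattice_def)
  qed
  moreover have "?c ` ?B = ?\<Gamma>"
  proof (intro equalityI subsetI)
    fix \<gamma> assume "\<gamma> \<in> ?c ` ?B"
    then show "\<gamma> \<in> ?\<Gamma>"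
      by (auto simp: lattice_def length_comps[OF opp_subset] sum_list_comps_opp)
  next
    fix \<gamma> assume \<gamma>: "\<gamma> \<in> ?\<Gamma>"
    let ?vs = "vlist gix v (opp v f)"
    define \<beta> where "\<beta> = map (\<lambda>i. if i \<in> f then \<alpha> ! i else the (map_of (zip ?vs \<gamma>) i)) [0..<Suc CARD('n)]"
    have nth: "\<beta> ! i = (if i \<in> f then \<alpha> ! i else the (map_of (zip ?vs \<gamma>) i))" if "i \<le> CARD('n)" for i
      using that by (simp add: \<beta>_def del: upt_Suc)
    have len: "length \<beta> = Suc CARD('n)" by (simp add: \<beta>_def)
    have \<beta>\<gamma>: "?c \<beta> = \<gamma>"
    proof (rule nth_equalityI)
      show "length (?c \<beta>) = length \<gamma>" using \<gamma> by (simp add: length_comps[OF opp_subset])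
      fix j assume "j < length (?c \<beta>)"
      then have j: "j < length ?vs" by (simp add: comps_def)
      then have "?vs ! j \<in> opp v f" using vlist(1)[OF opp_subset, of f] nth_mem by blast
      then have "?vs ! j \<le> CARD('n)" "?vs ! j \<notin> f" by (auto simp: opp_def)
      then have "?c \<beta> ! j = the (map_of (zip ?vs \<gamma>) (?vs ! j))"
        using j by (simp add: comps_def nth)
      also have "\<dots> = \<gamma> ! j"
      proof -
        have "map_of (zip ?vs \<gamma>) (?vs ! j) = Some (\<gamma> ! j)"
          using \<gamma> j vlist(3)[OF opp_subset, of f] by (intro map_of_zip_nth vlist(2)[OF opp_subset]) auto
        then show ?thesis by simp
      qed
      finally show "?c \<beta> ! j = \<gamma> ! j" .
    qed
    have ld: "ldist \<beta> f = ldist \<alpha> f"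
      using sum_list_comps_opp[OF len, of f] \<beta>\<gamma> \<gamma> by simp
    have cf: "comps gix v \<beta> f = comps gix v \<alpha> f"
      unfolding comps_eq_iff[OF f] using f by (auto simp: nth)
    have "sum_list \<beta> = sum_list \<alpha>"
      using sum_list_comps_add[OF len f] sum_list_comps_add[OF _ f, of \<alpha>] \<alpha> ld cf by (simp add: lattice_def)
    then have "\<beta> \<in> ?B" using \<alpha> len ld cf by (simp add: lattice_def)
    then show "\<gamma> \<in> ?c ` ?B" using \<beta>\<gamma> by blast
  qed
  ultimately show ?thesis by (simp add: bij_betw_def)
qed

end

lemma finite_lattice: "finite (lattice l j)"
proof (rule finite_subset)
  show "lattice l j \<subseteq> {\<mu>. set \<mu> \<subseteq> {..j} \<and> length \<mu> = l + 1}"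
    by (auto simp: lattice_def intro: member_le_sum_list)
qed (rule finite_lists_length_eq, simp)

text \<open>
  Linearity of the dual Bernstein functionals is given for pairs of restricted polynomials; the
  empty sum is the combination with coefficients 0.
\<close>

lemma linear_functional_sum:
  assumes b: "linear_functional j F b" and fin: "finite S" and p: "\<And>i. i \<in> S \<Longrightarrow> p i \<in> polys j"
  shows "b (restrict (\<lambda>x. \<Sum>i\<in>S. c i * p i x) F) = (\<Sum>i\<in>S. c i * b (restrict (p i) F))"
  using fin p
proof (induction S)
  case empty
  have "restrict (\<lambda>x. 0) F \<in> polys_on j F" using zero_in_polys by (auto simp: polys_on_def)
  from b[unfolded linear_functional_def, rule_format, OF this this, of 0 0]
  show ?case by (simp add: restrict_def)
next
  case (insert i S)
  let ?q = "\<lambda>x. \<Sum>i\<in>S. c i * p i x"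
  have pq: "restrict (p i) F \<in> polys_on j F" "restrict ?q F \<in> polys_on j F"
    using insert.prems polys_sum[of S p j c] unfolding polys_on_def by (intro imageI; simp)+
  have IH: "b (restrict ?q F) = (\<Sum>i\<in>S. c i * b (restrict (p i) F))"
    by (rule insert.IH) (simp add: insert.prems)
  have "b (\<lambda>x\<in>F. c i * restrict (p i) F x + 1 * restrict ?q F x) =
      c i * b (restrict (p i) F) + 1 * b (restrict ?q F)"
    by (rule b[unfolded linear_functional_def, rule_format, OF pq])
  moreover have "(\<lambda>x\<in>F. c i * restrict (p i) F x + 1 * restrict ?q F x) = restrict (\<lambda>x. \<Sum>i\<in>insert i S. c i * p i x) F"
    using insert.hyps by (intro restrict_ext) simp
  ultimately show ?case
    by (simp only: IH sum.insert[OF insert.hyps] mult_1_left)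
qed

lemma frame_deriv_in_polys:
  assumes "u \<in> polys k"
  shows "frame_deriv ns \<gamma> u \<in> polys (k - sum_list \<gamma>)"
proof -
  have "(\<lambda>x. \<Sum>I | length I = sum_list \<gamma>. tpow ns \<gamma> I * nabla u I x) \<in> polys (k - sum_list \<gamma>)"
    using nabla_in_polys[OF assms] by (intro polys_sum) (metis (mono_tags) mem_Collect_eq)
  moreover have "frame_deriv ns \<gamma> u = (\<lambda>x. \<Sum>I | length I = sum_list \<gamma>. tpow ns \<gamma> I * nabla u I x)"
    by (auto simp: frame_deriv_def tinner_def mult.commute)
  ultimately show ?thesis by simp
qed

lemma frame_deriv_sum:
  assumes "\<And>i. i \<in> S \<Longrightarrow> h i \<in> polys k"
  shows "frame_deriv ns \<gamma> (\<lambda>x. \<Sum>i\<in>S. c i * h i x) = (\<lambda>x. \<Sum>i\<in>S. c i * frame_deriv ns \<gamma> (h i) x)"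
proof
  fix x
  have "frame_deriv ns \<gamma> (\<lambda>x. \<Sum>i\<in>S. c i * h i x) x =
      (\<Sum>I | length I = sum_list \<gamma>. \<Sum>i\<in>S. c i * (nabla (h i) I x * tpow ns \<gamma> I))"
    by (simp add: frame_deriv_def tinner_def nabla_sum[OF assms] sum_distrib_right mult.assoc)
  also have "\<dots> = (\<Sum>i\<in>S. c i * frame_deriv ns \<gamma> (h i) x)"
    by (subst sum.swap) (simp add: frame_deriv_def tinner_def sum_distrib_left)
  finally show "frame_deriv ns \<gamma> (\<lambda>x. \<Sum>i\<in>S. c i * h i x) x = (\<Sum>i\<in>S. c i * frame_deriv ns \<gamma> (h i) x)" .
qed

lemma frame_deriv_frame_change:
  fixes u :: "real^'n \<Rightarrow> real"
  assumes u: "u \<in> polys k" and len: "length \<mu> = length ns"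
    and exp: "\<And>w. w \<in> set ns \<Longrightarrow> w = (\<Sum>i<p. (w \<bullet> E' i) *\<^sub>R E i)"
  shows "frame_deriv ns \<mu> u x =
    (\<Sum>\<gamma> | length \<gamma> = p \<and> sum_list \<gamma> = sum_list \<mu>.
       fact (sum_list \<mu>) / mfact \<gamma> *
       tinner (sum_list \<mu>) (tsym (sum_list \<mu>) (tpow ns \<mu>)) (tsym (sum_list \<mu>) (tpow (map E' [0..<p]) \<gamma>)) *
       frame_deriv (map E [0..<p]) \<gamma> u x)"
proof -
  define ws where "ws = concat (map2 replicate \<mu> ns)"
  have "length ws = sum_list \<mu> \<and> set ws \<subseteq> set ns"
    unfolding ws_def using len by (induction \<mu> ns rule: list_induct2) auto
  moreover have "symmetric_tensor (sum_list \<mu>) (\<lambda>I. nabla u I x)"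
    unfolding symmetric_tensor_def using nabla_symmetric[OF u] by metis
  ultimately have "tinner (sum_list \<mu>) (\<lambda>I. nabla u I x) (tprod ws) =
    (\<Sum>\<gamma> | length \<gamma> = p \<and> sum_list \<gamma> = sum_list \<mu>.
       fact (sum_list \<mu>) / mfact \<gamma> *
       tinner (sum_list \<mu>) (tsym (sum_list \<mu>) (tprod ws)) (tsym (sum_list \<mu>) (tpow (map E' [0..<p]) \<gamma>)) *
       tinner (sum_list \<mu>) (\<lambda>I. nabla u I x) (tpow (map E [0..<p]) \<gamma>))"
    using exp by (intro tinner_frame_change) auto
  moreover have "tpow ns \<mu> = tprod ws" by (simp add: tpow_def ws_def)
  ultimately show ?thesis by (simp add: frame_deriv_def cong: sum.cong_simp)
qed

locale transition = indexed_simplex v gix + smoothness_vector "CARD('n)" k r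
  for v :: "nat \<Rightarrow> real^'n" and gix k r +
  fixes N Nhat :: "(real^'n) set \<Rightarrow> nat \<Rightarrow> real^'n"
    and b :: "nat set \<Rightarrow> nat list \<Rightarrow> (real^'n \<Rightarrow> real) \<Rightarrow> real"
  assumes N: "\<And>l f. l < CARD('n) \<Longrightarrow> f \<in> subsimplices l {..CARD('n)} \<Longrightarrow> normal_basis v f (N (v ` f))"
    and Nhat: "\<And>l f i j. l < CARD('n) \<Longrightarrow> f \<in> subsimplices l {..CARD('n)} \<Longrightarrow>
      i < CARD('n) - l \<Longrightarrow> j < CARD('n) - l \<Longrightarrow>
      Nhat (v ` f) i \<bullet> N (v ` f) j = (if i = j then 1 else 0)"
    and b: "bernstein_dual gix v b"
begin

lemma dof_sum:
  assumes \<alpha>: "\<alpha> \<in> lattice CARD('n) k" and S: "finite S" "\<And>i. i \<in> S \<Longrightarrow> h i \<in> polys k"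
  shows "dof k r gix v b fr \<alpha> (\<lambda>x. \<Sum>i\<in>S. c i * h i x) = (\<Sum>i\<in>S. c i * dof k r gix v b fr \<alpha> (h i))"
proof -
  let ?f = "owner CARD('n) k r \<alpha>"
  obtain l where l: "l \<le> CARD('n)" "?f \<in> subsimplices l {..CARD('n)}"
    using owner_cases[OF \<alpha>] by blast
  have lin: "linear_functional (k - ldist \<alpha> ?f) (convex hull (v ` ?f)) (b ?f (comps gix v \<alpha> ?f))"
    using b l comps_in_lattice[OF \<alpha> l(2)] unfolding bernstein_dual_def by blast
  have mem: "frame_deriv (fr ?f) (comps gix v \<alpha> (opp v ?f)) (h i) \<in> polys (k - ldist \<alpha> ?f)"
    if "i \<in> S" for i
    using frame_deriv_in_polys[OF S(2)[OF that], of "fr ?f" "comps gix v \<alpha> (opp v ?f)"] \<alpha>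
    by (simp add: sum_list_comps_opp lattice_def)
  have fd: "frame_deriv ns \<gamma> (\<lambda>x. \<Sum>i\<in>S. c i * h i x) = (\<lambda>x. \<Sum>i\<in>S. c i * frame_deriv ns \<gamma> (h i) x)" for ns \<gamma>
    by (rule frame_deriv_sum) (rule S(2))
  show ?thesis
    unfolding dof_def Let_def fd by (rule linear_functional_sum[OF lin S(1) mem])
qed

text \<open>
  For \<open>f = T\<close> the frame is empty, so that a vector in it forces \<open>l < d\<close>, where the hypotheses on
  the normal frames apply.
\<close>

lemma tn_frame_expansion:
  assumes f: "l \<le> CARD('n)" "f \<in> subsimplices l {..CARD('n)}" and w: "w \<in> set (tn_frame gix v f)"
  shows "w = (\<Sum>i<card (opp v f). (w \<bullet> Nhat (v ` f) i) *\<^sub>R N (v ` f) i)"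
proof -
  have f': "f \<subseteq> {..CARD('n)}" "card f = l + 1" using f(2) by (auto simp: subsimplices_def)
  then have card: "card (opp v f) = CARD('n) - l"
    unfolding opp_def using finite_subset by (subst card_Diff_subset) auto
  obtain i where i: "i \<in> opp v f" "w = tn_vector v f i"
    using w vlist(1)[OF opp_subset] by (auto simp: tn_frame_def)
  have "l < CARD('n)"
    using i(1) card f(1) finite_subset[OF opp_subset] by (cases "l = CARD('n)") auto
  then show ?thesis
    using tn_vector_normal[OF f'(1) i(1)] N Nhat f(2) i(2) card
    by (intro normal_basis_expansion[of v f "N (v ` f)"]) auto
qed

lemma Tmat_eq:
  assumes \<alpha>: "\<alpha> \<in> lattice CARD('n) k" and \<beta>: "\<beta> \<in> lattice CARD('n) k"
  defines "f \<equiv> owner CARD('n) k r \<alpha>"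
  shows "Tmat k r gix v Nhat \<alpha> \<beta> =
    (if ldist \<beta> f = ldist \<alpha> f \<and> comps gix v \<beta> f = comps gix v \<alpha> f
     then fact (ldist \<alpha> f) / mfact (comps gix v \<beta> (opp v f)) *
       tinner (ldist \<alpha> f) (tsym (ldist \<alpha> f) (tpow (tn_frame gix v f) (comps gix v \<alpha> (opp v f))))
         (tsym (ldist \<alpha> f) (tpow (frame Nhat v f) (comps gix v \<beta> (opp v f))))
     else 0)"
proof -
  obtain l where l: "l \<le> CARD('n)" "f \<in> subsimplices l {..CARD('n)}" "\<alpha> \<in> latticeS CARD('n) k r l f"
    unfolding f_def using owner_cases[OF \<alpha>] by blast
  have f: "f \<subseteq> {..CARD('n)}" using l(2) by (simp add: subsimplices_def)
  have "(\<exists>l\<le>CARD('n). \<exists>f\<in>subsimplices l {..CARD('n)}. \<exists>s.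
           \<alpha> \<in> latticeS CARD('n) k r l f \<inter> latticeL CARD('n) k f s \<and>
           \<beta> \<in> latticeS CARD('n) k r l f \<inter> latticeL CARD('n) k f s \<and>
           comps gix v \<alpha> f = comps gix v \<beta> f) \<longleftrightarrow>
        ldist \<beta> f = ldist \<alpha> f \<and> comps gix v \<beta> f = comps gix v \<alpha> f" (is "?L \<longleftrightarrow> ?R")
  proof
    assume ?L
    then obtain l' f' s where f': "l' \<le> CARD('n)" "f' \<in> subsimplices l' {..CARD('n)}"
      "\<alpha> \<in> latticeS CARD('n) k r l' f'" "\<alpha> \<in> latticeL CARD('n) k f' s" "\<beta> \<in> latticeL CARD('n) k f' s"
      "comps gix v \<alpha> f' = comps gix v \<beta> f'"
      by blast
    have "f' = f" using owner_eq[OF f'(1-3)] by (simp add: f_def)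
    then show ?R using f'(4-6) by (simp add: latticeL_def)
  next
    assume R: ?R
    then have "\<forall>i\<in>f. \<beta> ! i = \<alpha> ! i" using comps_eq_iff[OF f] by blast
    then have "\<beta> \<in> latticeS CARD('n) k r l f"
      using latticeS_cong[OF \<beta> \<alpha> f] R l(3) by blast
    moreover have "\<alpha> \<in> latticeL CARD('n) k f (ldist \<alpha> f)" "\<beta> \<in> latticeL CARD('n) k f (ldist \<alpha> f)"
      using \<alpha> \<beta> R by (simp_all add: latticeL_def)
    ultimately show ?L using l R by (metis IntI)
  qed
  then show ?thesis unfolding Tmat_def f_def[symmetric] Let_def by simp
qed

text \<open>
  The identity \<open>L\<^sup>\<alpha> = \<Sum>\<^sub>\<beta> T\<^sub>\<alpha>\<^sub>,\<^sub>\<beta> G\<^sup>\<beta>\<close>.  On the support of the row the functional \<open>b\<close> is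
  the same for all \<open>\<beta>\<close>, so the sum can be moved inside it, where it becomes the pointwise change of
  frame.
\<close>

lemma dof_tn_frame_eq:
  assumes \<alpha>: "\<alpha> \<in> lattice CARD('n) k" and u: "u \<in> polys k"
  shows "dof k r gix v b (tn_frame gix v) \<alpha> u =
    (\<Sum>\<beta>\<in>lattice CARD('n) k. Tmat k r gix v Nhat \<alpha> \<beta> * dof k r gix v b (frame N v) \<beta> u)"
proof -
  define f where "f = owner CARD('n) k r \<alpha>"
  obtain l where l: "l \<le> CARD('n)" "f \<in> subsimplices l {..CARD('n)}" "\<alpha> \<in> latticeS CARD('n) k r l f"
    unfolding f_def using owner_cases[OF \<alpha>] by blast
  have f: "f \<subseteq> {..CARD('n)}" using l(2) by (simp add: subsimplices_def)
  define s where "s = ldist \<alpha> f"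
  define p where "p = card (opp v f)"
  define F where "F = convex hull (v ` f)"
  define c where "c \<beta> = comps gix v \<beta> (opp v f)" for \<beta>
  define b' where "b' = b f (comps gix v \<alpha> f)"
  define t where "t \<gamma> = fact s / mfact \<gamma> *
    tinner s (tsym s (tpow (tn_frame gix v f) (c \<alpha>))) (tsym s (tpow (frame Nhat v f) \<gamma>))" for \<gamma>
  define B where "B = {\<beta> \<in> lattice CARD('n) k. ldist \<beta> f = s \<and> comps gix v \<beta> f = comps gix v \<alpha> f}"
  define \<Gamma> where "\<Gamma> = {\<gamma>. length \<gamma> = p \<and> sum_list \<gamma> = s}"
  have bij: "bij_betw c B \<Gamma>"
    unfolding B_def \<Gamma>_def c_def s_def p_def by (rule bij_betw_comps_opp[OF \<alpha> f])
  have "finite B" unfolding B_def using finite_lattice by simp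
  then have fin: "finite \<Gamma>" using bij_betw_finite[OF bij] by simp
  have c\<alpha>: "length (c \<alpha>) = p" "sum_list (c \<alpha>) = s"
    using \<alpha> by (simp_all add: c_def p_def s_def length_comps[OF opp_subset] sum_list_comps_opp lattice_def)
  have lin: "linear_functional (k - s) F b'"
    using b l comps_in_lattice[OF \<alpha> l(2)] unfolding bernstein_dual_def F_def b'_def s_def by blast
  have dof\<beta>: "dof k r gix v b (frame N v) \<beta> u = b' (restrict (frame_deriv (frame N v f) (c \<beta>) u) F)"
    if "\<beta> \<in> B" for \<beta>
  proof -
    have \<beta>: "\<beta> \<in> lattice CARD('n) k" "ldist \<beta> f = ldist \<alpha> f" "comps gix v \<beta> f = comps gix v \<alpha> f"
      using that by (simp_all add: B_def s_def)
    then have "\<beta> \<in> latticeS CARD('n) k r l f"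
      using latticeS_cong[OF \<beta>(1) \<alpha> f \<beta>(2)] comps_eq_iff[OF f] l(3) by blast
    then have "owner CARD('n) k r \<beta> = f" by (rule owner_eq[OF l(1,2)])
    then show ?thesis by (simp add: dof_def F_def b'_def c_def \<beta>(3))
  qed
  have "(\<Sum>\<beta>\<in>lattice CARD('n) k. Tmat k r gix v Nhat \<alpha> \<beta> * dof k r gix v b (frame N v) \<beta> u) =
      (\<Sum>\<beta>\<in>B. t (c \<beta>) * b' (restrict (frame_deriv (frame N v f) (c \<beta>) u) F))"
  proof (rule sum.mono_neutral_cong_right[OF finite_lattice])
    show "\<forall>\<beta>\<in>lattice CARD('n) k - B. Tmat k r gix v Nhat \<alpha> \<beta> * dof k r gix v b (frame N v) \<beta> u = 0"
      using \<alpha> by (auto simp: B_def Tmat_eq f_def s_def)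
    show "Tmat k r gix v Nhat \<alpha> \<beta> * dof k r gix v b (frame N v) \<beta> u =
        t (c \<beta>) * b' (restrict (frame_deriv (frame N v f) (c \<beta>) u) F)" if "\<beta> \<in> B" for \<beta>
      using that \<alpha> unfolding dof\<beta>[OF that] by (simp add: B_def Tmat_eq t_def c_def s_def f_def)
  qed (auto simp: B_def)
  also have "\<dots> = (\<Sum>\<gamma>\<in>\<Gamma>. t \<gamma> * b' (restrict (frame_deriv (frame N v f) \<gamma> u) F))"
    by (rule sum.reindex_bij_betw[OF bij])
  also have "\<dots> = b' (restrict (\<lambda>x. \<Sum>\<gamma>\<in>\<Gamma>. t \<gamma> * frame_deriv (frame N v f) \<gamma> u x) F)"
    using frame_deriv_in_polys[OF u] by (intro linear_functional_sum[OF lin fin, symmetric]) (auto simp: \<Gamma>_def)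
  also have "(\<lambda>x. \<Sum>\<gamma>\<in>\<Gamma>. t \<gamma> * frame_deriv (frame N v f) \<gamma> u x) = frame_deriv (tn_frame gix v f) (c \<alpha>) u"
  proof
    fix x
    have len: "length (c \<alpha>) = length (tn_frame gix v f)"
      using c\<alpha>(1) vlist(3)[OF opp_subset] by (simp add: tn_frame_def p_def)
    have "frame_deriv (tn_frame gix v f) (c \<alpha>) u x =
      (\<Sum>\<gamma> | length \<gamma> = p \<and> sum_list \<gamma> = sum_list (c \<alpha>).
         fact (sum_list (c \<alpha>)) / mfact \<gamma> *
         tinner (sum_list (c \<alpha>)) (tsym (sum_list (c \<alpha>)) (tpow (tn_frame gix v f) (c \<alpha>)))
           (tsym (sum_list (c \<alpha>)) (tpow (map (Nhat (v ` f)) [0..<p]) \<gamma>)) *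
         frame_deriv (map (N (v ` f)) [0..<p]) \<gamma> u x)"
      using tn_frame_expansion[OF l(1,2)] by (intro frame_deriv_frame_change[OF u len]) (simp add: p_def)
    then show "(\<Sum>\<gamma>\<in>\<Gamma>. t \<gamma> * frame_deriv (frame N v f) \<gamma> u x) = frame_deriv (tn_frame gix v f) (c \<alpha>) u x"
      by (simp add: c\<alpha>(2) \<Gamma>_def p_def t_def frame_def)
  qed
  also have "b' (restrict (frame_deriv (tn_frame gix v f) (c \<alpha>) u) F) = dof k r gix v b (tn_frame gix v) \<alpha> u"
    by (simp only: dof_def Let_def f_def[symmetric] b'_def F_def c_def)
  finally show ?thesis by simp
qed

end

theorem theorem5p3:
  fixes \<T> :: "(real^'n) set set" and T :: "(real^'n) set"
    and gix :: "real^'n \<Rightarrow> nat" and v :: "nat \<Rightarrow> real^'n"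
    and m k :: nat and r :: "nat \<Rightarrow> nat"
    and N Nhat :: "(real^'n) set \<Rightarrow> nat \<Rightarrow> real^'n"
    and b :: "nat set \<Rightarrow> nat list \<Rightarrow> (real^'n \<Rightarrow> real) \<Rightarrow> real"
    and L G :: "nat list \<Rightarrow> (real^'n \<Rightarrow> real) \<Rightarrow> real"
    and \<psi> \<phi> :: "nat list \<Rightarrow> real^'n \<Rightarrow> real"
  assumes triangulation: "triangulation \<T>" "\<forall>K\<in>\<T>. int CARD('n) simplex K"
    and global_index: "inj_on gix {x. \<exists>K\<in>\<T>. x extreme_point_of K}"
    and T: "T \<in> \<T>" "bij_betw v {..CARD('n)} {x. x extreme_point_of T}"
    and r: "r CARD('n) = 0" "r (CARD('n) - 1) = m"
      "\<forall>l. l + 2 \<le> CARD('n) \<longrightarrow> r l \<ge> 2 * r (l + 1)"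
    and k: "k \<ge> 2 * r 0 + 1"
    and N: "\<forall>l<CARD('n). \<forall>f\<in>subsimplices l {..CARD('n)}. normal_basis v f (N (v ` f))"
    and Nhat: "\<forall>l<CARD('n). \<forall>f\<in>subsimplices l {..CARD('n)}. normal_basis v f (Nhat (v ` f)) \<and>
      (\<forall>i<CARD('n) - l. \<forall>j<CARD('n) - l.
         Nhat (v ` f) i \<bullet> N (v ` f) j = (if i = j then 1 else 0))"
    and b: "bernstein_dual gix v b"
    and L: "\<forall>\<alpha>\<in>lattice CARD('n) k. \<forall>u\<in>polys k. L \<alpha> u = dof k r gix v b (tn_frame gix v) \<alpha> u"
    and G: "\<forall>\<alpha>\<in>lattice CARD('n) k. \<forall>u\<in>polys k. G \<alpha> u = dof k r gix v b (frame N v) \<alpha> u"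
    and \<psi>: "dual_basis (polys k) (lattice CARD('n) k) L \<psi>"
    and \<phi>: "\<forall>\<beta>\<in>lattice CARD('n) k. \<forall>x.
      \<phi> \<beta> x = (\<Sum>\<alpha>\<in>lattice CARD('n) k. Tmat k r gix v Nhat \<alpha> \<beta> * \<psi> \<alpha> x)"
  shows "dual_basis (polys k) (lattice CARD('n) k) G \<phi> \<and>
    (\<forall>\<theta>. dual_basis (polys k) (lattice CARD('n) k) G \<theta> \<longrightarrow>
         (\<forall>\<beta>\<in>lattice CARD('n) k. \<theta> \<beta> = \<phi> \<beta>))"
proof -
  let ?A = "lattice CARD('n) k" and ?P = "Tmat k r gix v Nhat"
  obtain C where C: "\<not> affine_dependent C" "T = convex hull C"
    using triangulation(2) T(1) unfolding simplex_def by blast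
  have ext: "{x. x extreme_point_of T} = C"
    using extreme_point_of_convex_hull_affine_independent[OF C(1)] C(2) by auto
  have inj_v: "inj_on v {..CARD('n)}" and img: "v ` {..CARD('n)} = C"
    using T(2) ext by (auto simp: bij_betw_def)
  have "C \<subseteq> {x. \<exists>K\<in>\<T>. x extreme_point_of K}" using ext T(1) by blast
  then have "inj_on gix (v ` {..CARD('n)})" using global_index img inj_on_subset by blast
  then have inj_gix: "inj_on (\<lambda>i. gix (v i)) {..CARD('n)}"
    using comp_inj_on[OF inj_v] by (simp add: o_def)
  interpret transition v gix k r N Nhat b
    using inj_v img C(1) inj_gix r k N Nhat b by unfold_locales auto
  have lin: "G j (\<lambda>x. \<Sum>i\<in>?A. c i * h i x) = (\<Sum>i\<in>?A. c i * G j (h i))"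
    if "\<And>i. i \<in> ?A \<Longrightarrow> h i \<in> polys k" "j \<in> ?A" for c h j
    using dof_sum[OF that(2) finite_lattice that(1)] G that polys_sum[of ?A h k c]
    by (simp cong: sum.cong_simp)
  have LG: "L i u = (\<Sum>j\<in>?A. ?P i j * G j u)" if "i \<in> ?A" "u \<in> polys k" for i u
    using dof_tn_frame_eq[OF that] L G that by simp
  have \<phi>': "\<phi> j = (\<lambda>x. \<Sum>i\<in>?A. ?P i j * \<psi> i x)" if "j \<in> ?A" for j
    using \<phi> that by auto
  show ?thesis
    using dual_basis_change[OF finite_lattice polys_sum lin LG \<psi> \<phi>'] by blast
qed

end
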